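(* Let $H$ be a Banach space, $(\Omega,\mathcal{A},P)$ a probability space, and $\mu \in \mathcal{M}$. Then $(PAP(\mathbb{R},L^2(\Omega,P,H),\mu), \Vert \cdot \Vert_{\infty})$ is a Banach space, where $PAP(\mathbb{R},L^2(\Omega,P,H),\mu)$ is the space of all square-mean $\mu$-pseudo almost periodic stochastic processes $x : \mathbb{R} \to L^2(\Omega,P,H)$ and $\Vert x \Vert_{\infty} = \sup_{t \in \mathbb{R}} \left( E\Vert x(t) \Vert^2 \right)^{1/2}$.
   Context: $L^2(\Omega,P,H)$ is the space of all $H$-valued random variables $x$ with $E\Vert x \Vert^2 = \int_\Omega \Vert x \Vert^2 \, dP < +\infty$; it is a Banach space with the norm $\Vert x \Vert_{L^2} = (E\Vert x \Vert^2)^{1/2}$. $\mathcal{B}$ denotes the Lebesgue $\sigma$-field of $\mathbb{R}$ and $\mathcal{M}$ the set of all positive measures $\mu$ on $\mathcal{B}$ satisfying $\mu(\mathbb{R}) = +\infty$ and $\mu([a,b]) < +\infty$ for all $a \leq b$ in $\mathbb{R}$. A stochastic process $x : \mathbb{R} \to L^2(\Omega,P,H)$ is (stochastically) continuous if $\lim_{s \to t} E\Vert x(s)-x(t) \Vert^2 = 0$ for all $t \in \mathbb{R}$, and (stochastically) bounded if $\sup_{t \in \mathbb{R}} E\Vert x(t) \Vert^2 < +\infty$. A continuous stochastic process $x$ is square-mean almost periodic if for all $\varepsilon > 0$ there exists $\ell > 0$ such that for all $\alpha \in \mathbb{R}$ there exists $\tau \in [\alpha,\alpha+\ell]$ with $\sup_{t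 \in \mathbb{R}} E\Vert x(t+\tau)-x(t) \Vert^2 < \varepsilon$. For $\mu \in \mathcal{M}$, a continuous and bounded stochastic process $x$ is square-mean $\mu$-ergodic if $\lim_{r \to +\infty} \frac{1}{\mu([-r,r])} \int_{[-r,r]} E\Vert x(t) \Vert^2 \, d\mu(t) = 0$, and it is square-mean $\mu$-pseudo almost periodic if $x = y+z$ with $y$ square-mean almost periodic and $z$ square-mean $\mu$-ergodic. *)

theory Defs
  imports "HOL-Probability.Probability" "HOL-Algebra.Module"
begin

section \<open>Real Banach spaces on a carrier\<close>

text \<open>
  The spaces below depend on a measure, hence are not types, and the type class
  \<open>banach\<close> does not apply to them. The linear structure is that of a module of
  HOL-Algebra over the field of real numbers; the fields \<open>mult\<close> and \<open>one\<close> of the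
  module record play no role.
\<close>

definition real_field :: "real ring" where
  "real_field = \<lparr>carrier = UNIV, mult = (*), one = 1, zero = 0, add = (+)\<rparr>"

locale normed_space_on = Module.module real_field V
  for V :: "(real, 'v) module" (structure) +
  fixes N :: "'v \<Rightarrow> real"
  assumes N_nonneg: "x \<in> carrier V \<Longrightarrow> 0 \<le> N x"
    and N_eq_0_iff: "x \<in> carrier V \<Longrightarrow> N x = 0 \<longleftrightarrow> x = \<zero>\<^bsub>V\<^esub>"
    and N_smult: "x \<in> carrier V \<Longrightarrow> N (c \<odot>\<^bsub>V\<^esub> x) = \<bar>c\<bar> * N x"
    and N_triangle: "x \<in> carrier V \<Longrightarrow> y \<in> carrier V \<Longrightarrow> N (x \<oplus>\<^bsub>V\<^esub> y) \<le> N x + N y"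

locale banach_space_on = normed_space_on +
  assumes complete:
    "(\<forall>n. u n \<in> carrier V) \<Longrightarrow>
     (\<forall>e>0. \<exists>n0. \<forall>m\<ge>n0. \<forall>n\<ge>n0. N (u m \<ominus>\<^bsub>V\<^esub> u n) < e) \<Longrightarrow>
     (\<exists>l \<in> carrier V. (\<lambda>n. N (u n \<ominus>\<^bsub>V\<^esub> l)) \<longlonglongrightarrow> 0)"

section \<open>The space \<open>L\<^sup>2(\<Omega>,P,H)\<close>\<close>

text \<open>
  Random variables are strongly measurable functions, that is pointwise limits of
  sequences of simple functions. For separable \<open>H\<close> these are the Borel measurable
  functions; for nonseparable \<open>H\<close> sums of Borel measurable functions need not be
  measurable, so that the latter do not even form a vector space.
\<close>

definition random_var :: "'w measure \<Rightarrow> ('w \<Rightarrow> 'h::banach) \<Rightarrow> bool" where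
  "random_var P X \<longleftrightarrow>
     (\<exists>s. (\<forall>i. simple_function P (s i)) \<and> (\<forall>w\<in>space P. (\<lambda>i. s i w) \<longlonglongrightarrow> X w))"

definition ae_class :: "'w measure \<Rightarrow> ('w \<Rightarrow> 'h::banach) \<Rightarrow> ('w \<Rightarrow> 'h) set" where
  "ae_class P X = {Y. random_var P Y \<and> (AE w in P. Y w = X w)}"

definition rep :: "('w \<Rightarrow> 'h) set \<Rightarrow> 'w \<Rightarrow> 'h" where
  "rep A = (SOME X. X \<in> A)"

definition L2 :: "'w measure \<Rightarrow> (real, ('w \<Rightarrow> 'h::banach) set) module" where
  "L2 P = \<lparr>carrier = {ae_class P X | X. random_var P X \<and> integrable P (\<lambda>w. (norm (X w))\<^sup>2)},
           mult = undefined, one = undefined,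
           zero = ae_class P (\<lambda>w. 0),
           add = (\<lambda>A B. ae_class P (\<lambda>w. rep A w + rep B w)),
           smult = (\<lambda>c A. ae_class P (\<lambda>w. c *\<^sub>R rep A w))\<rparr>"

text \<open>\<open>E \<parallel>A\<parallel>\<^sup>2\<close> for a class \<open>A\<close> of random variables.\<close>

definition E_sq :: "'w measure \<Rightarrow> ('w \<Rightarrow> 'h::banach) set \<Rightarrow> real" where
  "E_sq P A = (\<integral>w. (norm (rep A w))\<^sup>2 \<partial>P)"

lemma rep_ae_class:
  assumes "random_var P X"
  shows "random_var P (rep (ae_class P X))" and "AE w in P. rep (ae_class P X) w = X w"
proof -
  have "X \<in> ae_class P X"
    using assms by (simp add: ae_class_def)
  then have "rep (ae_class P X) \<in> ae_class P X"
    unfolding rep_def by (rule someI[of "\<lambda>Z. Z \<in> ae_class P X"])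
  then show "random_var P (rep (ae_class P X))" "AE w in P. rep (ae_class P X) w = X w"
    by (auto simp: ae_class_def)
qed

lemma ae_class_eq_iff:
  assumes "random_var P X" "random_var P Y"
  shows "ae_class P X = ae_class P Y \<longleftrightarrow> (AE w in P. X w = Y w)"
proof
  assume "ae_class P X = ae_class P Y"
  moreover have "X \<in> ae_class P X"
    using assms by (simp add: ae_class_def)
  ultimately show "AE w in P. X w = Y w"
    by (simp add: ae_class_def)
next
  assume eq: "AE w in P. X w = Y w"
  have "(AE w in P. Z w = X w) \<longleftrightarrow> (AE w in P. Z w = Y w)" for Z
    using eq by (intro eventually_subst) auto
  then show "ae_class P X = ae_class P Y"
    by (auto simp: ae_class_def)
qed

lemma random_var_borel_measurable:
  assumes "random_var P X"
  shows "X \<in> borel_measurable P"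
proof -
  obtain s where s: "\<forall>i. simple_function P (s i)" "\<forall>w\<in>space P. (\<lambda>i. s i w) \<longlonglongrightarrow> X w"
    using assms by (auto simp: random_var_def)
  show ?thesis
    by (rule borel_measurable_LIMSEQ_metric[of s])
      (use s in \<open>auto intro: borel_measurable_simple_function\<close>)
qed

lemma E_sq_ae_class:
  assumes "random_var P X"
  shows "E_sq P (ae_class P X) = (\<integral>w. (norm (X w))\<^sup>2 \<partial>P)"
proof -
  note [measurable] = random_var_borel_measurable[OF assms]
    random_var_borel_measurable[OF rep_ae_class(1)[OF assms]]
  show ?thesis
    unfolding E_sq_def
    by (rule integral_cong_AE; (measurable)?) (use rep_ae_class(2)[OF assms] in auto)
qed

section \<open>Stochastic processes\<close>

definition process :: "'w measure \<Rightarrow> (real \<Rightarrow> ('w \<Rightarrow> 'h::banach) set) \<Rightarrow> bool" where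
  "process P x \<longleftrightarrow> (\<forall>t. x t \<in> carrier (L2 P))"

definition stoch_continuous :: "'w measure \<Rightarrow> (real \<Rightarrow> ('w \<Rightarrow> 'h::banach) set) \<Rightarrow> bool" where
  "stoch_continuous P x \<longleftrightarrow> (\<forall>t. ((\<lambda>s. E_sq P (x s \<ominus>\<^bsub>L2 P\<^esub> x t)) \<longlongrightarrow> 0) (at t))"

definition stoch_bounded :: "'w measure \<Rightarrow> (real \<Rightarrow> ('w \<Rightarrow> 'h::banach) set) \<Rightarrow> bool" where
  "stoch_bounded P x \<longleftrightarrow> bdd_above (range (\<lambda>t. E_sq P (x t)))"

definition sq_mean_ap :: "'w measure \<Rightarrow> (real \<Rightarrow> ('w \<Rightarrow> 'h::banach) set) \<Rightarrow> bool" where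
  "sq_mean_ap P x \<longleftrightarrow> process P x \<and> stoch_continuous P x \<and>
     (\<forall>\<epsilon>>0. \<exists>l>0. \<forall>\<alpha>. \<exists>\<tau>\<in>{\<alpha>..\<alpha> + l}.
        (SUP t. ereal (E_sq P (x (t + \<tau>) \<ominus>\<^bsub>L2 P\<^esub> x t))) < ereal \<epsilon>)"

definition measures_M :: "real measure set" where
  "measures_M = {\<mu>. sets \<mu> = sets lebesgue \<and> emeasure \<mu> UNIV = \<infinity> \<and>
     (\<forall>a b. a \<le> b \<longrightarrow> emeasure \<mu> {a..b} < \<infinity>)}"

definition sq_mean_ergodic ::
  "'w measure \<Rightarrow> real measure \<Rightarrow> (real \<Rightarrow> ('w \<Rightarrow> 'h::banach) set) \<Rightarrow> bool" where
  "sq_mean_ergodic P \<mu> x \<longleftrightarrow> process P x \<and> stoch_continuous P x \<and> stoch_bounded P x \<and>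
     ((\<lambda>r. 1 / measure \<mu> {-r..r} * (LINT t:{-r..r}|\<mu>. E_sq P (x t))) \<longlongrightarrow> 0) at_top"

definition sq_mean_pap ::
  "'w measure \<Rightarrow> real measure \<Rightarrow> (real \<Rightarrow> ('w \<Rightarrow> 'h::banach) set) \<Rightarrow> bool" where
  "sq_mean_pap P \<mu> x \<longleftrightarrow> process P x \<and> stoch_continuous P x \<and> stoch_bounded P x \<and>
     (\<exists>y z. sq_mean_ap P y \<and> sq_mean_ergodic P \<mu> z \<and> (\<forall>t. x t = y t \<oplus>\<^bsub>L2 P\<^esub> z t))"

definition PAP ::
  "'w measure \<Rightarrow> real measure \<Rightarrow> (real, real \<Rightarrow> ('w \<Rightarrow> 'h::banach) set) module" where
  "PAP P \<mu> = \<lparr>carrier = {x. sq_mean_pap P \<mu> x},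
              mult = undefined, one = undefined,
              zero = (\<lambda>t. \<zero>\<^bsub>L2 P\<^esub>),
              add = (\<lambda>x y t. x t \<oplus>\<^bsub>L2 P\<^esub> y t),
              smult = (\<lambda>c x t. c \<odot>\<^bsub>L2 P\<^esub> x t)\<rparr>"

definition sup_norm :: "'w measure \<Rightarrow> (real \<Rightarrow> ('w \<Rightarrow> 'h::banach) set) \<Rightarrow> real" where
  "sup_norm P x = (SUP t. sqrt (E_sq P (x t)))"

end

theory Submission
  imports Defs
begin

text \<open>
  Write \<open>x = y + z\<close> with \<open>y\<close> almost periodic, \<open>z\<close> ergodic, and suppose \<open>\<parallel>x\<parallel>\<^sub>\<infinity> \<le> c\<close>. Since \<open>\<mu>\<close> need
  not be translation invariant, the decomposition is not unique and \<open>\<parallel>y\<parallel>\<^sub>\<infinity>\<close> is not controlled by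
  \<open>\<parallel>x\<parallel>\<^sub>\<infinity>\<close>. However, the radial retraction \<open>T\<close> onto the ball of radius \<open>c\<close> is Lipschitz, so \<open>T \<circ> y\<close> is
  almost periodic, and \<open>\<parallel>y - T y\<parallel> = max 0 (\<parallel>y\<parallel> - c) \<le> \<parallel>z\<parallel>\<close> pointwise, so \<open>y - T y\<close> is ergodic. Hence
  \<open>y\<close> and \<open>z\<close> can be chosen with \<open>\<parallel>y\<parallel>\<^sub>\<infinity> \<le> c\<close> and \<open>\<parallel>z\<parallel>\<^sub>\<infinity> \<le> 2c\<close>, and a rapidly converging Cauchy
  sequence splits into Cauchy sequences of almost periodic and of ergodic functions, both of which
  are closed under uniform limits.
\<close>

section \<open>Almost periodic semimetrics on the real line\<close>

text \<open>An extreme case of the obstacle: let \<open>\<mu>\<close> count the integers in a set.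
  Then t -> sin(pi t) v is almost periodic and ergodic at once, so zero is the sum of K sin(pi t) v
  and its negative for every K. Decompositions chosen separately for the members of a Cauchy
  sequence can therefore drift apart. Only the increments u (n+1) - u n are decomposed with control
  by their norm, and the two parts are added to the decomposition already fixed for u n. Sums are a
  second difficulty: relatively dense sets of almost periods of two functions do not visibly share
  elements, so closure under addition is obtained through translates instead. Of the space of square
  integrable variables the argument uses only that it is a Banach space, so it runs in an arbitrary
  Banach space on a carrier. Norms replace expected squares there, because the expected square of a
  difference violates the triangle inequality.\<close>

definition semimetric :: "(real \<Rightarrow> real \<Rightarrow> real) \<Rightarrow> bool" where
  "semimetric d \<longleftrightarrow> (\<forall>s t. 0 \<le> d s t) \<and> (\<forall>s. d s s = 0) \<and> (\<forall>s t. d s t = d t s) \<and>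
     (\<forall>r s t. d r t \<le> d r s + d s t)"

text \<open>Almost periodicity of a function x enters only through the distances
  \<open>d s t = N (x s \<ominus> x t)\<close>, so it is formulated for \<open>d\<close>. Sums of
  functions are then dominated by sums of semimetrics, and Lipschitz images by multiples.\<close>

definition ap_semimetric :: "(real \<Rightarrow> real \<Rightarrow> real) \<Rightarrow> bool" where
  "ap_semimetric d \<longleftrightarrow> semimetric d \<and> (\<forall>t. ((\<lambda>s. d s t) \<longlongrightarrow> 0) (at t)) \<and>
     (\<forall>\<epsilon>>0. \<exists>l>0. \<forall>\<alpha>. \<exists>\<tau>\<in>{\<alpha>..\<alpha> + l}. \<forall>t. d (t + \<tau>) t \<le> \<epsilon>)"

lemma semimetric_add:
  assumes "semimetric d" "semimetric d'"
  shows "semimetric (\<lambda>s t. d s t + d' s t)"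
proof -
  have "d r t + d' r t \<le> (d r s + d' r s) + (d s t + d' s t)" for r s t
  proof -
    have "d r t \<le> d r s + d s t" "d' r t \<le> d' r s + d' s t"
      using assms unfolding semimetric_def by blast+
    then show ?thesis by linarith
  qed
  then show ?thesis
    using assms unfolding semimetric_def by (metis add_nonneg_nonneg add.right_neutral)
qed

lemma semimetric_approx_tendsto:
  assumes "semimetric d'"
    and approx: "\<And>\<epsilon>. 0 < \<epsilon> \<Longrightarrow>
      \<exists>d C. ((\<lambda>s. d s t) \<longlongrightarrow> 0) (at t) \<and> (\<forall>s. d' s t \<le> C * d s t + \<epsilon>)"
  shows "((\<lambda>s. d' s t) \<longlongrightarrow> (0::real)) (at t)"
proof (rule tendstoI)
  fix e :: real assume "0 < e"
  then obtain d C where d: "((\<lambda>s. d s t) \<longlongrightarrow> 0) (at t)" "\<And>s. d' s t \<le> C * d s t + e / 2"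
    using approx[of "e/2"] by auto
  have "((\<lambda>s. C * d s t + e / 2) \<longlongrightarrow> C * 0 + e / 2) (at t)"
    by (intro tendsto_intros d)
  then have "\<forall>\<^sub>F s in at t. C * d s t + e / 2 < e"
    by (rule order_tendstoD) (use \<open>0 < e\<close> in simp)
  then show "\<forall>\<^sub>F s in at t. dist (d' s t) 0 < e"
  proof eventually_elim
    case (elim s)
    then show ?case
      using d(2)[of s] assms(1) by (simp add: semimetric_def)
  qed
qed

text \<open>An almost period of \<open>d\<close> for \<open>\<epsilon> / 2 / C\<close> is one of
  \<open>d'\<close> for \<open>\<epsilon>\<close>. Since \<open>d\<close> and \<open>C\<close> may
  vary with \<open>\<epsilon>\<close>, one criterion covers Lipschitz images (\<open>d\<close> and
  \<open>C\<close> fixed) and uniform limits (\<open>C = 1\<close>, \<open>d\<close> from a far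
  member of the sequence).\<close>

lemma ap_semimetric_approx:
  assumes "semimetric d'"
    and approx: "\<And>\<epsilon>. 0 < \<epsilon> \<Longrightarrow>
      \<exists>d C. ap_semimetric d \<and> 0 < C \<and> (\<forall>s t. d' s t \<le> C * d s t + \<epsilon>)"
  shows "ap_semimetric d'"
proof -
  have "((\<lambda>s. d' s t) \<longlongrightarrow> 0) (at t)" for t
  proof (rule semimetric_approx_tendsto[OF assms(1)])
    fix e :: real assume "0 < e"
    then show "\<exists>d C. ((\<lambda>s. d s t) \<longlongrightarrow> 0) (at t) \<and> (\<forall>s. d' s t \<le> C * d s t + e)"
      using approx[of e] unfolding ap_semimetric_def by blast
  qed
  moreover have "\<exists>l>0. \<forall>\<alpha>. \<exists>\<tau>\<in>{\<alpha>..\<alpha> + l}. \<forall>t. d' (t + \<tau>) t \<le> e" if e: "0 < e" for e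
  proof -
    obtain d C where d: "ap_semimetric d" "0 < C" "\<And>s t. d' s t \<le> C * d s t + e / 2"
      using approx[of "e/2"] e by auto
    have "0 < e / 2 / C" using e d by simp
    then obtain l where l: "0 < l" "\<And>\<alpha>. \<exists>\<tau>\<in>{\<alpha>..\<alpha> + l}. \<forall>t. d (t + \<tau>) t \<le> e / 2 / C"
      using d(1) unfolding ap_semimetric_def by blast
    have "d' s t \<le> e" if "d s t \<le> e / 2 / C" for s t
    proof -
      have "C * d s t \<le> e / 2"
        using that d(2) by (simp add: field_simps)
      then show ?thesis using d(3)[of s t] by linarith
    qed
    then show ?thesis using l by (meson)
  qed
  ultimately show ?thesis
    using assms(1) unfolding ap_semimetric_def by blast
qed

text \<open>Continuity at the diagonal spreads to the plane by the quadrilateral inequality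
  \<open>\<bar>d s t - d a b\<bar> \<le> d s a + d t b\<close>. The purpose is Heine-Cantor on
  compact squares.\<close>

lemma semimetric_continuous:
  assumes d: "semimetric d" and c: "\<And>t. ((\<lambda>s. d s t) \<longlongrightarrow> 0) (at t)"
  shows "continuous_on UNIV (\<lambda>p. d (fst p) (snd p))"
proof -
  have "isCont (\<lambda>p. d (fst p) (snd p)) (a, b)" for a b
  proof -
    have c0: "isCont (\<lambda>s. d s t) t" for t
      using c[of t] d by (simp add: isCont_def semimetric_def)
    have 1: "((\<lambda>p. d (fst p) a) \<longlongrightarrow> d a a) (at (a, b))"
      using isCont_tendsto_compose[OF c0[of a], of fst "at (a,b)"] tendsto_fst[OF tendsto_ident_at, of "(a,b)" UNIV] by simp
    have 2: "((\<lambda>p. d (snd p) b) \<longlongrightarrow> d b b) (at (a, b))"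
      using isCont_tendsto_compose[OF c0[of b], of snd "at (a,b)"] tendsto_snd[OF tendsto_ident_at, of "(a,b)" UNIV] by simp
    have 3: "((\<lambda>p. d (fst p) a + d (snd p) b) \<longlongrightarrow> 0) (at (a, b))"
      using tendsto_add[OF 1 2] d by (simp add: semimetric_def)
    have "\<bar>d (fst p) (snd p) - d a b\<bar> \<le> d (fst p) a + d (snd p) b" for p
    proof -
      have tri: "d r t \<le> d r s + d s t" and sym: "d r s = d s r" for r s t
        using d unfolding semimetric_def by blast+
      show ?thesis
        using tri[of "fst p" "snd p" a] tri[of a "snd p" b] tri[of a b "fst p"] tri[of "fst p" b "snd p"]
          sym[of a "fst p"] sym[of b "snd p"] by linarith
    qed
    then have "((\<lambda>p. d (fst p) (snd p) - d a b) \<longlongrightarrow> 0) (at (a, b))"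
      by (intro Lim_null_comparison[OF _ 3]) (simp add: eventually_at_filter)
    then show ?thesis
      by (simp add: isCont_def LIM_zero_iff)
  qed
  then show ?thesis
    by (auto intro!: continuous_at_imp_continuous_on)
qed

text \<open>Bochner's criterion: almost periodicity amounts to total boundedness of the family
  of translates for the uniform distance.\<close>

definition totally_bounded_translates :: "(real \<Rightarrow> real \<Rightarrow> real) \<Rightarrow> bool" where
  "totally_bounded_translates d \<longleftrightarrow>
     (\<forall>\<epsilon>>0. \<exists>F. finite F \<and> (\<forall>a. \<exists>b\<in>F. \<forall>t. d (t + a) (t + b) \<le> \<epsilon>))"

text \<open>An almost period carries two nearby points together into a fixed compact interval, where
  Heine-Cantor applies; the displacement costs \<open>\<epsilon> / 3\<close> at either
  point.\<close>

lemma ap_semimetric_uniformly_continuous: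
  assumes "ap_semimetric d" "0 < \<epsilon>"
  obtains \<delta> where "0 < \<delta>" "\<And>s t. \<bar>s - t\<bar> < \<delta> \<Longrightarrow> d s t \<le> \<epsilon>"
proof -
  have d: "semimetric d" and c: "\<And>t. ((\<lambda>s. d s t) \<longlongrightarrow> 0) (at t)"
    using assms unfolding ap_semimetric_def by auto
  have tri: "d r t \<le> d r s + d s t" and sym: "d r s = d s r" and d0: "d r r = 0" for r s t
    using d unfolding semimetric_def by blast+
  have "0 < \<epsilon> / 3" using assms by simp
  then obtain l where l: "0 < l" "\<And>\<alpha>. \<exists>\<tau>\<in>{\<alpha>..\<alpha> + l}. \<forall>t. d (t + \<tau>) t \<le> \<epsilon> / 3"
    using assms unfolding ap_semimetric_def by blast
  \<comment> \<open>The almost period chosen below lies in \<open>{-t..-t+l}\<close> and so moves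
    \<open>t\<close> into \<open>{0..l}\<close>. The margin 1 keeps the image of \<open>s\<close> in
    range as well, whence \<open>min \<delta> 1\<close>.\<close>
  let ?K = "{-1..l+1::real} \<times> {-1..l+1::real}"
  have "uniformly_continuous_on ?K (\<lambda>p. d (fst p) (snd p))"
    by (intro compact_uniformly_continuous continuous_on_subset[OF semimetric_continuous[OF d c]]
        compact_Times) auto
  then obtain \<delta> where \<delta>: "0 < \<delta>" "\<And>p q. p \<in> ?K \<Longrightarrow> q \<in> ?K \<Longrightarrow> dist q p < \<delta> \<Longrightarrow>
      dist (d (fst q) (snd q)) (d (fst p) (snd p)) < \<epsilon> / 3"
    using \<open>0 < \<epsilon> / 3\<close> unfolding uniformly_continuous_on_def by meson
  have "d s t \<le> \<epsilon>" if st: "\<bar>s - t\<bar> < min \<delta> 1" for s t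
  proof -
    obtain \<tau> where \<tau>: "\<tau> \<in> {-t..-t+l}" "\<And>t. d (t + \<tau>) t \<le> \<epsilon> / 3"
      using l(2) by blast
    have "s + \<tau> \<in> {-1..l+1}" "t + \<tau> \<in> {-1..l+1}"
      using st \<tau>(1) by (auto simp: abs_less_iff)
    then have "dist (d (s + \<tau>) (t + \<tau>)) (d (t + \<tau>) (t + \<tau>)) < \<epsilon> / 3"
      using \<delta>(2)[of "(t + \<tau>, t + \<tau>)" "(s + \<tau>, t + \<tau>)"] st by (simp add: dist_Pair_Pair dist_real_def)
    then have "d (s + \<tau>) (t + \<tau>) < \<epsilon> / 3"
      by (simp add: d0 dist_real_def)
    then show ?thesis
      using tri[of s t "s + \<tau>"] tri[of "s + \<tau>" t "t + \<tau>"] sym[of s "s + \<tau>"] \<tau>(2)[of s] \<tau>(2)[of t]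
      by linarith
  qed
  then show ?thesis
    using that[of "min \<delta> 1"] \<delta>(1) by simp
qed

text \<open>Up to an almost period every shift may be taken from \<open>{0..l}\<close>, and by
  uniform continuity a finite \<open>\<delta>\<close>-net of that interval suffices.\<close>

lemma ap_semimetric_totally_bounded_translates:
  assumes "ap_semimetric d"
  shows "totally_bounded_translates d"
  unfolding totally_bounded_translates_def
proof (intro allI impI)
  fix \<epsilon> :: real assume \<epsilon>: "0 < \<epsilon>"
  have d: "semimetric d"
    using assms unfolding ap_semimetric_def by auto
  have tri: "d r t \<le> d r s + d s t" and sym: "d r s = d s r" and d0: "d r r = 0" for r s t
    using d unfolding semimetric_def by blast+
  have "0 < \<epsilon> / 2" using \<epsilon> by simp
  then obtain l where l: "0 < l" "\<And>\<alpha>. \<exists>\<tau>\<in>{\<alpha>..\<alpha> + l}. \<forall>t. d (t + \<tau>) t \<le> \<epsilon> / 2"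
    using assms unfolding ap_semimetric_def by blast
  obtain \<delta> where \<delta>: "0 < \<delta>" "\<And>s t. \<bar>s - t\<bar> < \<delta> \<Longrightarrow> d s t \<le> \<epsilon> / 2"
    using ap_semimetric_uniformly_continuous[OF assms \<open>0 < \<epsilon> / 2\<close>] by blast
  have "compact {0..l}" by simp
  then obtain F where F: "finite F" "{0..l} \<subseteq> (\<Union>b\<in>F. ball b \<delta>)"
    using \<delta>(1) unfolding compact_eq_totally_bounded by blast
  have "\<exists>b\<in>F. \<forall>t. d (t + a) (t + b) \<le> \<epsilon>" for a
  proof -
    obtain \<tau> where \<tau>: "\<tau> \<in> {-a..-a+l}" "\<And>t. d (t + \<tau>) t \<le> \<epsilon> / 2"
      using l(2) by blast
    have "a + \<tau> \<in> {0..l}" using \<tau>(1) by simp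
    then obtain b where b: "b \<in> F" "a + \<tau> \<in> ball b \<delta>"
      using F(2) by blast
    have "d (t + a) (t + b) \<le> \<epsilon>" for t
    proof -
      have "d (t + a + \<tau>) (t + b) \<le> \<epsilon> / 2"
        using b(2) by (intro \<delta>) (simp add: dist_real_def abs_minus_commute)
      then show ?thesis
        using tri[of "t + a" "t + b" "t + a + \<tau>"] \<tau>(2)[of "t + a"] sym[of "t + a" "t + a + \<tau>"]
        by linarith
    qed
    then show ?thesis using b(1) by blast
  qed
  then show "\<exists>F. finite F \<and> (\<forall>a. \<exists>b\<in>F. \<forall>t. d (t + a) (t + b) \<le> \<epsilon>)"
    using F(1) by blast
qed

text \<open>If the shifts by \<open>\<alpha> + L\<close> and by some \<open>b \<in> F\<close> agree
  up to \<open>\<epsilon>\<close>, their difference is an almost period, and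
  \<open>\<bar>b\<bar> \<le> L\<close> places it in
  \<open>{\<alpha>..\<alpha> + 2 * L}\<close>.\<close>

lemma totally_bounded_translates_imp_ap:
  assumes "semimetric d" "\<And>t. ((\<lambda>s. d s t) \<longlongrightarrow> 0) (at t)" "totally_bounded_translates d"
  shows "ap_semimetric d"
  unfolding ap_semimetric_def
proof (intro conjI allI impI assms)
  fix \<epsilon> :: real assume "0 < \<epsilon>"
  then obtain F where F: "finite F" "\<And>a. \<exists>b\<in>F. \<forall>t. d (t + a) (t + b) \<le> \<epsilon>"
    using assms(3) unfolding totally_bounded_translates_def by blast
  obtain L where L: "0 < L" "\<And>b. b \<in> F \<Longrightarrow> \<bar>b\<bar> \<le> L"
    using finite_imp_bounded[OF F(1)] unfolding bounded_pos by auto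
  have "\<exists>\<tau>\<in>{\<alpha>..\<alpha> + 2 * L}. \<forall>t. d (t + \<tau>) t \<le> \<epsilon>" for \<alpha>
  proof -
    obtain b where b: "b \<in> F" "\<And>t. d (t + (\<alpha> + L)) (t + b) \<le> \<epsilon>"
      using F(2) by blast
    have "d (t + (\<alpha> + L - b)) t \<le> \<epsilon>" for t
      using b(2)[of "t - b"] by (simp add: algebra_simps)
    moreover have "\<alpha> + L - b \<in> {\<alpha>..\<alpha> + 2 * L}"
      using L(2)[OF b(1)] by (simp add: abs_le_iff)
    ultimately show ?thesis by blast
  qed
  then show "\<exists>l>0. \<forall>\<alpha>. \<exists>\<tau>\<in>{\<alpha>..\<alpha> + l}. \<forall>t. d (t + \<tau>) t \<le> \<epsilon>"
    using L(1) by (intro exI[of _ "2 * L"]) simp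
qed

text \<open>Finite nets combine: the pairs in \<open>F \<times> F'\<close> sort all shifts into
  finitely many cells, and two shifts of one cell differ by at most four times
  \<open>\<epsilon> / 4\<close> in the sum.\<close>

lemma totally_bounded_translates_add:
  assumes "semimetric d" "semimetric d'"
    and "totally_bounded_translates d" "totally_bounded_translates d'"
  shows "totally_bounded_translates (\<lambda>s t. d s t + d' s t)"
  unfolding totally_bounded_translates_def
proof (intro allI impI)
  fix \<epsilon> :: real assume "0 < \<epsilon>"
  then have \<epsilon>: "0 < \<epsilon> / 4" by simp
  obtain F where F: "finite F" "\<And>a. \<exists>b\<in>F. \<forall>t. d (t + a) (t + b) \<le> \<epsilon> / 4"
    using assms(3) \<epsilon> unfolding totally_bounded_translates_def by blast
  obtain F' where F': "finite F'" "\<And>a. \<exists>b\<in>F'. \<forall>t. d' (t + a) (t + b) \<le> \<epsilon> / 4"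
    using assms(4) \<epsilon> unfolding totally_bounded_translates_def by blast
  define near where "near p a \<longleftrightarrow>
    (\<forall>t. d (t + a) (t + fst p) \<le> \<epsilon> / 4) \<and> (\<forall>t. d' (t + a) (t + snd p) \<le> \<epsilon> / 4)" for p a
  \<comment> \<open>A pair is not a shift, so each cell is represented by one of its members. An
    empty cell contributes an arbitrary number, which merely enlarges \<open>G\<close>.\<close>
  define G where "G = (\<lambda>p. SOME a. near p a) ` (F \<times> F')"
  have "\<exists>b\<in>G. \<forall>t. d (t + a) (t + b) + d' (t + a) (t + b) \<le> \<epsilon>" for a
  proof -
    obtain b b' where "b \<in> F" "b' \<in> F'" and a: "near (b, b') a"
      using F(2)[of a] F'(2)[of a] unfolding near_def by auto
    define c where "c = (SOME a. near (b, b') a)"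
    have c: "near (b, b') c"
      unfolding c_def by (rule someI[of "near (b, b')", OF a])
    have "d (t + a) (t + c) + d' (t + a) (t + c) \<le> \<epsilon>" for t
    proof -
      have "d (t + a) (t + c) \<le> d (t + a) (t + b) + d (t + c) (t + b)"
        "d' (t + a) (t + c) \<le> d' (t + a) (t + b') + d' (t + c) (t + b')"
        using assms(1,2) unfolding semimetric_def by metis+
      moreover have "d (t + a) (t + b) \<le> \<epsilon> / 4" "d (t + c) (t + b) \<le> \<epsilon> / 4"
        "d' (t + a) (t + b') \<le> \<epsilon> / 4" "d' (t + c) (t + b') \<le> \<epsilon> / 4"
        using a c unfolding near_def by auto
      ultimately show ?thesis by linarith
    qed
    moreover have "c \<in> G"
      unfolding G_def c_def using \<open>b \<in> F\<close> \<open>b' \<in> F'\<close> by blast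
    ultimately show ?thesis by blast
  qed
  moreover have "finite G"
    unfolding G_def using F(1) F'(1) by simp
  ultimately show "\<exists>F. finite F \<and> (\<forall>a. \<exists>b\<in>F. \<forall>t. d (t + a) (t + b) + d' (t + a) (t + b) \<le> \<epsilon>)"
    by blast
qed

lemma ap_semimetric_add:
  assumes "ap_semimetric d" "ap_semimetric d'"
  shows "ap_semimetric (\<lambda>s t. d s t + d' s t)"
proof (rule totally_bounded_translates_imp_ap)
  have d: "semimetric d" "semimetric d'"
    using assms by (auto simp: ap_semimetric_def)
  show "semimetric (\<lambda>s t. d s t + d' s t)"
    using d by (rule semimetric_add)
  show "totally_bounded_translates (\<lambda>s t. d s t + d' s t)"
    using d assms by (intro totally_bounded_translates_add ap_semimetric_totally_bounded_translates)
  show "((\<lambda>s. d s t + d' s t) \<longlongrightarrow> 0) (at t)" for t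
    using assms tendsto_add[of "\<lambda>s. d s t" 0 "at t" "\<lambda>s. d' s t" 0] unfolding ap_semimetric_def by auto
qed

lemma ap_semimetric_bounded:
  assumes "ap_semimetric d"
  obtains B where "\<And>t. d t 0 \<le> B"
proof -
  obtain F where F: "finite F" "\<And>a. \<exists>b\<in>F. \<forall>t. d (t + a) (t + b) \<le> 1"
    using ap_semimetric_totally_bounded_translates[OF assms] zero_less_one
    unfolding totally_bounded_translates_def by blast
  have "d a 0 \<le> 1 + (\<Sum>b\<in>F. d b 0)" for a
  proof -
    obtain b where b: "b \<in> F" "\<And>t. d (t + a) (t + b) \<le> 1"
      using F(2) by blast
    have "d a 0 \<le> d a b + d b 0" "0 \<le> d s t" for s t
      using assms unfolding ap_semimetric_def semimetric_def by blast+
    moreover from this(2) have "d b 0 \<le> (\<Sum>b\<in>F. d b 0)"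
      using F(1) b(1) by (intro member_le_sum) auto
    ultimately show ?thesis using b(2)[of 0] by simp
  qed
  then show ?thesis by (rule that)
qed

section \<open>Functions of mean value zero\<close>

definition mean_value :: "real measure \<Rightarrow> (real \<Rightarrow> real) \<Rightarrow> real \<Rightarrow> real" where
  "mean_value \<mu> f r = 1 / measure \<mu> {-r..r} * (LINT t:{-r..r}|\<mu>. f t)"

lemma measures_M_set_integrable:
  assumes "\<mu> \<in> measures_M" "continuous_on UNIV f"
  shows "set_integrable \<mu> {-r..r} (f :: real \<Rightarrow> real)"
proof (cases "0 \<le> r")
  case True
  have sets: "sets \<mu> = sets lebesgue" and fin: "emeasure \<mu> {-r..r} < \<infinity>"
    using assms True unfolding measures_M_def by auto
  have "f \<in> borel_measurable lborel"
    using assms(2) by (simp add: borel_measurable_continuous_onI)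
  then have "f \<in> borel_measurable lebesgue"
    by (rule measurable_completion)
  then have f: "f \<in> borel_measurable \<mu>"
    using measurable_cong_sets[OF sets refl] by blast
  have A: "{-r..r} \<in> sets \<mu>" unfolding sets by simp
  have "bounded (f ` {-r..r})"
    using assms(2) by (intro compact_imp_bounded compact_continuous_image)
      (auto intro: continuous_on_subset)
  then obtain B where B: "\<And>t. t \<in> {-r..r} \<Longrightarrow> norm (f t) \<le> B"
    unfolding bounded_iff by (meson imageI)
  show ?thesis
    unfolding set_integrable_def
    by (rule integrableI_bounded_set_indicator[OF A f fin]) (use B in auto)
next
  case False
  then show ?thesis by (simp add: set_integrable_def)
qed

lemma mean_value_mono:
  assumes "\<mu> \<in> measures_M" "continuous_on UNIV f" "continuous_on UNIV g" "\<And>t. f t \<le> g t"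
  shows "mean_value \<mu> f r \<le> mean_value \<mu> g r"
  unfolding mean_value_def
  using assms by (intro mult_left_mono set_integral_mono measures_M_set_integrable) auto

lemma mean_value_linear:
  assumes "\<mu> \<in> measures_M" "continuous_on UNIV f" "continuous_on UNIV g"
  shows "mean_value \<mu> (\<lambda>t. a * f t + b * g t) r = a * mean_value \<mu> f r + b * mean_value \<mu> g r"
proof -
  have "(LINT t:{-r..r}|\<mu>. a * f t + b * g t) =
      a * (LINT t:{-r..r}|\<mu>. f t) + b * (LINT t:{-r..r}|\<mu>. g t)"
    using assms by (subst set_integral_add) (auto intro: measures_M_set_integrable)
  then show ?thesis
    unfolding mean_value_def by (simp add: algebra_simps)
qed

text \<open>Equality fails when the interval is null or empty, since \<open>1 / 0 = 0\<close> makes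
  the mean 0 there. The upper bound controls the additive error in
  \<open>mean_value_tendsto_zero\<close>.\<close>

lemma mean_value_one_le:
  assumes "\<mu> \<in> measures_M"
  shows "mean_value \<mu> (\<lambda>t. 1) r \<le> 1"
proof (cases "0 \<le> r")
  case True
  have "{-r..r} \<in> sets \<mu>" "emeasure \<mu> {-r..r} < \<infinity>"
    using assms True unfolding measures_M_def by auto
  then show ?thesis
    unfolding mean_value_def by (simp add: set_lebesgue_integral_def)
next
  case False
  then show ?thesis by (simp add: mean_value_def)
qed

text \<open>Averaging the domination leaves a multiple of a mean that tends to 0, plus at most the
  error. This is the counterpart for means of \<open>ap_semimetric_approx\<close>.\<close>

lemma mean_value_tendsto_zero:
  assumes \<mu>: "\<mu> \<in> measures_M" and f: "continuous_on UNIV f" "\<And>t. 0 \<le> f t"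
    and approx: "\<And>\<epsilon>. 0 < \<epsilon> \<Longrightarrow> \<exists>g C. continuous_on UNIV g \<and> (mean_value \<mu> g \<longlongrightarrow> 0) at_top \<and>
      (\<forall>t. f t \<le> C * g t + \<epsilon>)"
  shows "(mean_value \<mu> f \<longlongrightarrow> 0) at_top"
proof (rule tendstoI)
  fix e :: real assume e: "0 < e"
  \<comment> \<open>The factor 1 lets \<open>mean_value_linear\<close> apply with the constant
    function 1 as second function.\<close>
  then obtain g C where g: "continuous_on UNIV g" "(mean_value \<mu> g \<longlongrightarrow> 0) at_top"
    "\<And>t. f t \<le> C * g t + e / 2 * 1"
    using approx[of "e/2"] by auto
  have le: "mean_value \<mu> f r \<le> C * mean_value \<mu> g r + e / 2" for r
  proof -
    have "mean_value \<mu> f r \<le> mean_value \<mu> (\<lambda>t. C * g t + e / 2 * 1) r"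
      using g by (intro mean_value_mono[OF \<mu> f(1)] continuous_intros) auto
    also have "\<dots> = C * mean_value \<mu> g r + e / 2 * mean_value \<mu> (\<lambda>t. 1) r"
      using g by (intro mean_value_linear[OF \<mu>]) auto
    also have "\<dots> \<le> C * mean_value \<mu> g r + e / 2 * 1"
      using e mean_value_one_le[OF \<mu>] by (intro add_left_mono mult_left_mono) auto
    finally show ?thesis by simp
  qed
  have nonneg: "0 \<le> mean_value \<mu> f r" for r
    unfolding mean_value_def set_lebesgue_integral_def
    using f(2) by (intro mult_nonneg_nonneg Bochner_Integration.integral_nonneg) auto
  have "((\<lambda>r. C * mean_value \<mu> g r + e / 2) \<longlongrightarrow> C * 0 + e / 2) at_top"
    by (intro tendsto_intros g)
  then have "\<forall>\<^sub>F r in at_top. C * mean_value \<mu> g r + e / 2 < e"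
    by (rule order_tendstoD) (use e in simp)
  then show "\<forall>\<^sub>F r in at_top. dist (mean_value \<mu> f r) 0 < e"
  proof eventually_elim
    case (elim r)
    then show ?case using le[of r] nonneg[of r] by simp
  qed
qed

section \<open>Normed spaces on a carrier\<close>

lemma real_field_simps [simp]:
  "carrier real_field = UNIV" "a \<oplus>\<^bsub>real_field\<^esub> b = a + b" "a \<otimes>\<^bsub>real_field\<^esub> b = a * b"
  "\<zero>\<^bsub>real_field\<^esub> = 0" "\<one>\<^bsub>real_field\<^esub> = 1"
  by (simp_all add: real_field_def)

lemma cring_real_field: "cring real_field"
proof (rule cringI)
  show "abelian_group real_field"
    by (rule abelian_groupI) (auto intro: exI[of _ "- x" for x] simp: add.assoc add.commute)
  show "Group.comm_monoid real_field"
    by (rule comm_monoidI) auto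
qed (auto simp: algebra_simps)

text \<open>With \<open>a\<close> and \<open>b\<close> the norms of two vectors, this is the share
  of the Lipschitz estimate that stems from the change of the scaling factor. In the main case both
  exceed \<open>c\<close>, and the left side is \<open>c / a * \<bar>a - b\<bar>\<close> with
  \<open>c / a < 1\<close>.\<close>

lemma radial_factor_diff:
  fixes a b c :: real
  assumes "0 \<le> a" "0 \<le> b" "0 \<le> c"
  shows "\<bar>min 1 (c / a) - min 1 (c / b)\<bar> * b \<le> \<bar>a - b\<bar>"
proof (cases "a = 0 \<or> b = 0")
  \<comment> \<open>As \<open>c / 0 = 0\<close>, the factor at 0 is 0 and not 1; the estimate
    survives because both factors lie between 0 and 1.\<close>
  case True
  then show ?thesis
    using assms by (auto simp: min_def field_simps)
next
  case False
  then have ab: "0 < a" "0 < b" using assms by auto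
  have eq: "\<bar>c / a - c / b\<bar> * b = c / a * \<bar>a - b\<bar>"
  proof -
    have "c / a - c / b = c / a * (b - a) / b" using ab by (simp add: field_simps)
    then show ?thesis using ab assms by (simp add: abs_mult abs_minus_commute)
  qed
  consider "a \<le> c" "b \<le> c" | "a \<le> c" "c < b" | "c < a" "b \<le> c" | "c < a" "c < b" by linarith
  then show ?thesis
  proof cases
    case 1
    then show ?thesis using ab by (simp add: min_def field_simps)
  next
    case 2
    then have "min 1 (c / a) = 1" "min 1 (c / b) = c / b" using ab by (auto simp: min_def field_simps)
    moreover have "\<bar>1 - c / b\<bar> * b = b - c" using 2 ab by (simp add: field_simps abs_if)
    ultimately show ?thesis using 2 by simp
  next
    case 3
    then have "min 1 (c / a) = c / a" "min 1 (c / b) = 1" using ab by (auto simp: min_def field_simps)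
    moreover have "\<bar>c / a - 1\<bar> * b = (a - c) * (b / a)" using 3 ab by (simp add: field_simps abs_if)
    moreover have "(a - c) * (b / a) \<le> (a - c) * 1" using 3 ab by (intro mult_left_mono) auto
    ultimately show ?thesis using 3 by simp
  next
    case 4
    then have "min 1 (c / a) = c / a" "min 1 (c / b) = c / b" using ab by (auto simp: min_def field_simps)
    moreover have "c / a * \<bar>a - b\<bar> \<le> 1 * \<bar>a - b\<bar>" using 4 ab by (intro mult_right_mono) auto
    ultimately show ?thesis using eq by simp
  qed
qed

context normed_space_on
begin

lemma smult_real_closed [simp, intro]: "x \<in> carrier V \<Longrightarrow> c \<odot> x \<in> carrier V"
  using smult_closed[of c x] by simp

lemma minus_eq_smult: "x \<in> carrier V \<Longrightarrow> \<ominus> x = (-1) \<odot> x"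
  using smult_l_distr[of "-1" 1 x] smult_l_null[of x] smult_one[of x]
  by (intro minus_equality) auto

lemma N_zero [simp]: "N \<zero> = 0"
  using N_eq_0_iff[of "\<zero>"] by simp

lemma N_uminus: "x \<in> carrier V \<Longrightarrow> N (\<ominus> x) = N x"
  using N_smult[of x "-1"] by (simp add: minus_eq_smult)

lemma minus_add_minus:
  assumes "x \<in> carrier V" "y \<in> carrier V" "z \<in> carrier V"
  shows "(x \<ominus> z) \<oplus> (z \<ominus> y) = x \<ominus> y"
  using assms by (simp add: a_minus_def a_assoc r_neg1)

lemma add_minus_add:
  assumes "x \<in> carrier V" "y \<in> carrier V" "x' \<in> carrier V" "y' \<in> carrier V"
  shows "(x \<oplus> y) \<ominus> (x' \<oplus> y') = (x \<ominus> x') \<oplus> (y \<ominus> y')"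
  using assms by (simp add: a_minus_def minus_add a_ac)

lemma minus_add_cancel_right:
  assumes "x \<in> carrier V" "y \<in> carrier V"
  shows "(x \<ominus> y) \<oplus> y = x"
  using assms by (simp add: a_minus_def a_assoc l_neg)

lemma smult_minus:
  assumes "x \<in> carrier V" "y \<in> carrier V"
  shows "c \<odot> x \<ominus> c \<odot> y = c \<odot> (x \<ominus> y)"
  using assms by (simp add: a_minus_def smult_r_distr smult_r_minus)

lemma N_minus_commute:
  assumes "x \<in> carrier V" "y \<in> carrier V"
  shows "N (x \<ominus> y) = N (y \<ominus> x)"
proof -
  have "\<ominus> (x \<ominus> y) = y \<ominus> x"
    using assms by (simp add: a_minus_def minus_add a_comm)
  then show ?thesis
    using N_uminus[of "x \<ominus> y"] assms by simp
qed

lemma N_triangle_minus: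
  assumes "x \<in> carrier V" "y \<in> carrier V" "z \<in> carrier V"
  shows "N (x \<ominus> y) \<le> N (x \<ominus> z) + N (z \<ominus> y)"
  using N_triangle[of "x \<ominus> z" "z \<ominus> y"] minus_add_minus[OF assms] assms by simp

lemma N_add_minus_add_le:
  assumes "x \<in> carrier V" "y \<in> carrier V" "x' \<in> carrier V" "y' \<in> carrier V"
  shows "N ((x \<oplus> y) \<ominus> (x' \<oplus> y')) \<le> N (x \<ominus> x') + N (y \<ominus> y')"
  unfolding add_minus_add[OF assms] using assms by (intro N_triangle) auto

lemma N_minus_le:
  assumes "x \<in> carrier V" "y \<in> carrier V"
  shows "N (x \<ominus> y) \<le> N x + N y"
  using N_triangle[of x "\<ominus> y"] assms by (simp add: a_minus_def N_uminus)

lemma N_le_add_minus: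
  assumes "x \<in> carrier V" "y \<in> carrier V"
  shows "N x \<le> N (x \<ominus> y) + N y"
  using N_triangle[of "x \<ominus> y" y] minus_add_cancel_right[OF assms] assms by simp

lemma abs_N_diff_le:
  assumes "x \<in> carrier V" "y \<in> carrier V"
  shows "\<bar>N x - N y\<bar> \<le> N (x \<ominus> y)"
  using N_le_add_minus[OF assms] N_le_add_minus[OF assms(2,1)] N_minus_commute[OF assms] by linarith

section \<open>Geometrically fast Cauchy sequences\<close>

lemma fast_Cauchy_dist_le:
  assumes u: "\<And>n. u n \<in> carrier V" and fast: "\<And>n. N (u (Suc n) \<ominus> u n) \<le> C * (1/2) ^ n"
    and "n \<le> m"
  shows "N (u m \<ominus> u n) \<le> 2 * C * (1/2) ^ n"
proof -
  have "0 \<le> N (u 1 \<ominus> u 0)" using u by (simp add: N_nonneg)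
  then have C: "0 \<le> C" using fast[of 0] by simp
  \<comment> \<open>The subtracted tail makes the induction close: from \<open>k\<close> to
    \<open>Suc k\<close> the bound grows by exactly \<open>C * (1/2) ^ k\<close>.\<close>
  have "N (u m \<ominus> u n) \<le> 2 * C * (1/2) ^ n - 2 * C * (1/2) ^ m"
    using \<open>n \<le> m\<close>
  proof (induction m rule: dec_induct)
    case base
    then show ?case using u by (simp add: a_minus_def r_neg)
  next
    case (step k)
    have "N (u (Suc k) \<ominus> u n) \<le> N (u (Suc k) \<ominus> u k) + N (u k \<ominus> u n)"
      using u by (intro N_triangle_minus) auto
    then show ?case
      using step.IH fast[of k] by simp
  qed
  moreover have "0 \<le> 2 * C * (1/2) ^ m" using C by simp
  ultimately show ?thesis by linarith
qed

text \<open>A Cauchy sequence converges as soon as a subsequence does, and some subsequence has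
  increments below \<open>(1/2) ^ n\<close>. Both completeness proofs below start from this
  reduction.\<close>

lemma banach_space_on_if_fast_Cauchy_converges:
  assumes conv: "\<And>u. (\<And>n. u n \<in> carrier V) \<Longrightarrow> (\<And>n. N (u (Suc n) \<ominus> u n) \<le> (1/2) ^ n) \<Longrightarrow>
    \<exists>l\<in>carrier V. (\<lambda>n. N (u n \<ominus> l)) \<longlonglongrightarrow> 0"
  shows "banach_space_on V N"
proof
  fix u
  assume u: "\<forall>n. u n \<in> carrier V"
    and cauchy: "\<forall>e>0. \<exists>n0::nat. \<forall>m\<ge>n0. \<forall>n\<ge>n0. N (u m \<ominus> u n) < e"
  have "\<forall>k. \<exists>n0. \<forall>m\<ge>n0. \<forall>n\<ge>n0. N (u m \<ominus> u n) < (1/2) ^ k"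
    using cauchy by simp
  then obtain M where M: "\<And>k m n. M k \<le> m \<Longrightarrow> M k \<le> n \<Longrightarrow> N (u m \<ominus> u n) < (1/2) ^ k"
    by metis
  \<comment> \<open>The sum dominates \<open>M k\<close> and is nondecreasing in \<open>k\<close>
    although \<open>M\<close> need not be; the summand \<open>k\<close> makes the indices tend to
    infinity.\<close>
  define \<phi> where "\<phi> k = (\<Sum>i\<le>k. M i) + k" for k
  have \<phi>: "M k \<le> \<phi> k" "\<phi> k \<le> \<phi> (Suc k)" "k \<le> \<phi> k" for k
    unfolding \<phi>_def by (auto intro: trans_le_add1 member_le_sum)
  have "N (u (\<phi> (Suc k)) \<ominus> u (\<phi> k)) \<le> (1/2) ^ k" for k
    using M[of k "\<phi> (Suc k)" "\<phi> k"] \<phi>(1)[of k] \<phi>(2)[of k] by fastforce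
  then obtain l where l: "l \<in> carrier V" "(\<lambda>k. N (u (\<phi> k) \<ominus> l)) \<longlonglongrightarrow> 0"
    using conv[of "u \<circ> \<phi>"] u by auto
  have "(\<lambda>n. N (u n \<ominus> l)) \<longlonglongrightarrow> 0"
  proof (rule LIMSEQ_I)
    fix e :: real assume "0 < e"
    then have "0 < e / 2" by simp
    then obtain n0 where n0: "\<forall>m\<ge>n0. \<forall>n\<ge>n0. N (u m \<ominus> u n) < e / 2"
      using cauchy by blast
    obtain k0 where k0: "\<And>k. k0 \<le> k \<Longrightarrow> N (u (\<phi> k) \<ominus> l) < e / 2"
      using order_tendstoD(2)[OF l(2) \<open>0 < e / 2\<close>] unfolding eventually_sequentially by blast
    have "norm (N (u n \<ominus> l) - 0) < e" if n: "n0 \<le> n" for n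
    proof -
      let ?k = "max n0 k0"
      have "n0 \<le> \<phi> ?k" using \<phi>(3)[of ?k] by simp
      then have "N (u n \<ominus> u (\<phi> ?k)) < e / 2" using n0 n by blast
      moreover have "N (u (\<phi> ?k) \<ominus> l) < e / 2" using k0 by simp
      moreover have "N (u n \<ominus> l) \<le> N (u n \<ominus> u (\<phi> ?k)) + N (u (\<phi> ?k) \<ominus> l)"
        using u l(1) by (intro N_triangle_minus) auto
      moreover have "0 \<le> N (u n \<ominus> l)" using u l(1) by (simp add: N_nonneg)
      ultimately show ?thesis by simp
    qed
    then show "\<exists>n0. \<forall>n\<ge>n0. norm (N (u n \<ominus> l) - 0) < e" by blast
  qed
  then show "\<exists>l\<in>carrier V. (\<lambda>n. N (u n \<ominus> l)) \<longlonglongrightarrow> 0" using l(1) by blast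
qed

subsection \<open>The radial retraction onto a ball\<close>

text \<open>At the zero vector \<open>c / 0 = 0\<close> gives the factor 0; zero is still mapped to
  itself, as a retraction requires.\<close>

definition radial :: "real \<Rightarrow> 'v \<Rightarrow> 'v" where
  "radial c x = min 1 (c / N x) \<odot> x"

lemma radial_closed [simp, intro]: "x \<in> carrier V \<Longrightarrow> radial c x \<in> carrier V"
  by (simp add: radial_def)

lemma N_radial_le:
  assumes "x \<in> carrier V" "0 \<le> c"
  shows "N (radial c x) \<le> c"
proof -
  have "0 \<le> N x" using assms by (simp add: N_nonneg)
  then show ?thesis
    using assms by (cases "N x = 0") (auto simp: radial_def N_smult min_def field_simps)
qed

lemma N_minus_radial:
  assumes x: "x \<in> carrier V" and "0 \<le> c"
  shows "N (x \<ominus> radial c x) = max 0 (N x - c)"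
proof -
  let ?a = "min 1 (c / N x)"
  have "x \<ominus> radial c x = 1 \<odot> x \<oplus> (- ?a) \<odot> x"
    using x smult_assoc1[of "-1" ?a x] smult_one[OF x]
    by (simp add: radial_def a_minus_def minus_eq_smult)
  also have "\<dots> = (1 - ?a) \<odot> x"
    using x smult_l_distr[of 1 "- ?a" x] by simp
  finally have "N (x \<ominus> radial c x) = (1 - ?a) * N x"
    using x by (simp add: N_smult)
  moreover have "0 \<le> N x" using x by (simp add: N_nonneg)
  ultimately show ?thesis
    using \<open>0 \<le> c\<close>
    by (cases "N x = 0"; cases "N x \<le> c") (auto simp: min_def max_def divide_le_eq left_diff_distrib)
qed

text \<open>First the vector moves with its factor, at most 1, held fixed; then the factor changes.
  Each move costs at most \<open>N (x \<ominus> y)\<close>, which accounts for the 2.\<close>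

lemma radial_Lipschitz:
  assumes x: "x \<in> carrier V" and y: "y \<in> carrier V" and "0 \<le> c"
  shows "N (radial c x \<ominus> radial c y) \<le> 2 * N (x \<ominus> y)"
proof -
  let ?a = "min 1 (c / N x)" and ?b = "min 1 (c / N y)"
  have nn: "0 \<le> N x" "0 \<le> N y" "0 \<le> N (x \<ominus> y)" using x y by (auto simp: N_nonneg)
  have "radial c x \<ominus> radial c y = (?a \<odot> x \<ominus> ?a \<odot> y) \<oplus> (?a \<odot> y \<ominus> ?b \<odot> y)"
    using x y by (simp add: radial_def minus_add_minus)
  moreover have "?a \<odot> y \<ominus> ?b \<odot> y = (?a - ?b) \<odot> y"
    using y smult_l_distr[of ?a "- ?b" y] smult_assoc1[of "-1" ?b y]
    by (simp add: a_minus_def minus_eq_smult)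
  ultimately have "N (radial c x \<ominus> radial c y) \<le> \<bar>?a\<bar> * N (x \<ominus> y) + \<bar>?a - ?b\<bar> * N y"
    using N_triangle[of "?a \<odot> (x \<ominus> y)" "(?a - ?b) \<odot> y"] x y
    by (simp add: smult_minus N_smult)
  moreover have "\<bar>?a\<bar> * N (x \<ominus> y) \<le> 1 * N (x \<ominus> y)"
    using nn \<open>0 \<le> c\<close> by (intro mult_right_mono) auto
  moreover have "\<bar>?a - ?b\<bar> * N y \<le> \<bar>N x - N y\<bar>"
    using nn \<open>0 \<le> c\<close> by (intro radial_factor_diff) auto
  ultimately show ?thesis
    using abs_N_diff_le[OF x y] by linarith
qed

subsection \<open>Almost periodic, ergodic and pseudo almost periodic functions\<close>

definition cont_fun :: "(real \<Rightarrow> 'v) \<Rightarrow> bool" where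
  "cont_fun x \<longleftrightarrow> (\<forall>t. x t \<in> carrier V) \<and> (\<forall>t. ((\<lambda>s. N (x s \<ominus> x t)) \<longlongrightarrow> 0) (at t))"

definition ap_fun :: "(real \<Rightarrow> 'v) \<Rightarrow> bool" where
  "ap_fun x \<longleftrightarrow> (\<forall>t. x t \<in> carrier V) \<and> ap_semimetric (\<lambda>s t. N (x s \<ominus> x t))"

text \<open>The squared norm is averaged because for \<open>L2_norm\<close> it is the expected
  square \<open>E_sq\<close>.\<close>

definition ergodic_fun :: "real measure \<Rightarrow> (real \<Rightarrow> 'v) \<Rightarrow> bool" where
  "ergodic_fun \<mu> x \<longleftrightarrow> cont_fun x \<and> (\<exists>B. \<forall>t. N (x t) \<le> B) \<and>
     (mean_value \<mu> (\<lambda>t. (N (x t))\<^sup>2) \<longlongrightarrow> 0) at_top"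

definition pap_fun :: "real measure \<Rightarrow> (real \<Rightarrow> 'v) \<Rightarrow> bool" where
  "pap_fun \<mu> x \<longleftrightarrow> (\<exists>y z. ap_fun y \<and> ergodic_fun \<mu> z \<and> (\<forall>t. x t = y t \<oplus> z t))"

section \<open>Closure under sums, multiples, retraction and uniform limits\<close>

lemma semimetric_fun:
  assumes "\<And>t. x t \<in> carrier V"
  shows "semimetric (\<lambda>s t. N (x s \<ominus> x t))"
  unfolding semimetric_def
  using assms by (auto simp: N_nonneg N_triangle_minus intro: N_minus_commute) (simp add: a_minus_def r_neg)

lemma cont_fun_approx:
  assumes "\<And>t. x t \<in> carrier V"
    and "\<And>\<epsilon>. 0 < \<epsilon> \<Longrightarrow> \<exists>y C. cont_fun y \<and> (\<forall>s t. N (x s \<ominus> x t) \<le> C * N (y s \<ominus> y t) + \<epsilon>)"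
  shows "cont_fun x"
  unfolding cont_fun_def
proof (intro conjI allI assms(1))
  fix t
  show "((\<lambda>s. N (x s \<ominus> x t)) \<longlongrightarrow> 0) (at t)"
  proof (rule semimetric_approx_tendsto[of "\<lambda>s t. N (x s \<ominus> x t)"])
    show "semimetric (\<lambda>s t. N (x s \<ominus> x t))"
      using assms(1) by (rule semimetric_fun)
    fix e :: real assume "0 < e"
    then obtain y C where "cont_fun y" "\<forall>s t. N (x s \<ominus> x t) \<le> C * N (y s \<ominus> y t) + e"
      using assms(2) by blast
    then show "\<exists>d C. ((\<lambda>s. d s t) \<longlongrightarrow> 0) (at t) \<and> (\<forall>s. N (x s \<ominus> x t) \<le> C * d s t + e)"
      unfolding cont_fun_def by (intro exI[of _ "\<lambda>s t. N (y s \<ominus> y t)"] exI[of _ C]) auto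
  qed
qed

lemma cont_fun_add:
  assumes "cont_fun x" "cont_fun y"
  shows "cont_fun (\<lambda>t. x t \<oplus> y t)"
proof -
  have car: "x t \<in> carrier V" "y t \<in> carrier V" for t
    using assms by (auto simp: cont_fun_def)
  have "((\<lambda>s. N ((x s \<oplus> y s) \<ominus> (x t \<oplus> y t))) \<longlongrightarrow> 0) (at t)" for t
  proof (rule Lim_null_comparison)
    show "((\<lambda>s. N (x s \<ominus> x t) + N (y s \<ominus> y t)) \<longlongrightarrow> 0) (at t)"
      using tendsto_add[of "\<lambda>s. N (x s \<ominus> x t)" 0 "at t" "\<lambda>s. N (y s \<ominus> y t)" 0] assms
      by (simp add: cont_fun_def)
    have "norm (N ((x s \<oplus> y s) \<ominus> (x t \<oplus> y t))) \<le> N (x s \<ominus> x t) + N (y s \<ominus> y t)" for s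
      using N_add_minus_add_le[of "x s" "y s" "x t" "y t"] car by (simp add: N_nonneg)
    then show "\<forall>\<^sub>F s in at t. norm (N ((x s \<oplus> y s) \<ominus> (x t \<oplus> y t))) \<le> N (x s \<ominus> x t) + N (y s \<ominus> y t)"
      by simp
  qed
  then show ?thesis
    using car by (simp add: cont_fun_def)
qed

lemma continuous_on_N:
  assumes "cont_fun x"
  shows "continuous_on UNIV (\<lambda>t. N (x t))"
proof -
  have car: "x t \<in> carrier V" for t using assms by (simp add: cont_fun_def)
  have "((\<lambda>s. N (x s) - N (x t)) \<longlongrightarrow> 0) (at t)" for t
  proof (rule Lim_null_comparison)
    show "((\<lambda>s. N (x s \<ominus> x t)) \<longlongrightarrow> 0) (at t)" using assms by (simp add: cont_fun_def)
  qed (simp add: abs_N_diff_le car)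
  then show ?thesis
    by (auto intro!: continuous_at_imp_continuous_on simp: isCont_def LIM_zero_iff)
qed

lemma ap_fun_imp_cont_fun: "ap_fun x \<Longrightarrow> cont_fun x"
  by (simp add: ap_fun_def cont_fun_def ap_semimetric_def)

lemma ap_fun_bounded:
  assumes "ap_fun x"
  obtains B where "\<And>t. N (x t) \<le> B"
proof -
  have car: "x t \<in> carrier V" for t using assms by (simp add: ap_fun_def)
  obtain B where B: "\<And>t. N (x t \<ominus> x 0) \<le> B"
    using ap_semimetric_bounded[of "\<lambda>s t. N (x s \<ominus> x t)"] assms unfolding ap_fun_def by blast
  have "N (x t) \<le> B + N (x 0)" for t
    using B[of t] N_le_add_minus[OF car car, of t 0] by linarith
  then show ?thesis by (rule that)
qed

lemma ap_fun_approx: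
  assumes "\<And>t. x t \<in> carrier V"
    and "\<And>\<epsilon>. 0 < \<epsilon> \<Longrightarrow> \<exists>y C. ap_fun y \<and> 0 < C \<and> (\<forall>s t. N (x s \<ominus> x t) \<le> C * N (y s \<ominus> y t) + \<epsilon>)"
  shows "ap_fun x"
  unfolding ap_fun_def
proof (intro conjI allI assms(1) ap_semimetric_approx semimetric_fun)
  fix e :: real assume "0 < e"
  then obtain y C where "ap_fun y" "0 < C" "\<forall>s t. N (x s \<ominus> x t) \<le> C * N (y s \<ominus> y t) + e"
    using assms(2) by blast
  then show "\<exists>d C. ap_semimetric d \<and> 0 < C \<and> (\<forall>s t. N (x s \<ominus> x t) \<le> C * d s t + e)"
    unfolding ap_fun_def by blast
qed

lemma ap_fun_add:
  assumes "ap_fun x" "ap_fun y"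
  shows "ap_fun (\<lambda>t. x t \<oplus> y t)"
proof -
  have car: "x t \<in> carrier V" "y t \<in> carrier V" for t
    using assms by (auto simp: ap_fun_def)
  have "ap_semimetric (\<lambda>s t. N (x s \<ominus> x t) + N (y s \<ominus> y t))"
    using assms by (intro ap_semimetric_add) (auto simp: ap_fun_def)
  moreover have "semimetric (\<lambda>s t. N ((x s \<oplus> y s) \<ominus> (x t \<oplus> y t)))"
    using car by (intro semimetric_fun) auto
  moreover have "N ((x s \<oplus> y s) \<ominus> (x t \<oplus> y t)) \<le> 1 * (N (x s \<ominus> x t) + N (y s \<ominus> y t)) + e" if "0 < e" for e s t
    using N_add_minus_add_le[of "x s" "y s" "x t" "y t"] car that by simp
  ultimately have "ap_semimetric (\<lambda>s t. N ((x s \<oplus> y s) \<ominus> (x t \<oplus> y t)))"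
    by (intro ap_semimetric_approx) (blast intro: zero_less_one)+
  then show ?thesis
    using car by (simp add: ap_fun_def)
qed

lemma ap_fun_smult:
  assumes "ap_fun x"
  shows "ap_fun (\<lambda>t. c \<odot> x t)"
proof (rule ap_fun_approx)
  have car: "x t \<in> carrier V" for t using assms by (simp add: ap_fun_def)
  then show "c \<odot> x t \<in> carrier V" for t by simp
  fix e :: real assume "0 < e"
  moreover have "0 \<le> N (x s \<ominus> x t)" for s t using car by (simp add: N_nonneg)
  \<comment> \<open>The added 1 keeps the constant positive when \<open>c = 0\<close>, as
    \<open>ap_fun_approx\<close> demands.\<close>
  ultimately have "N (c \<odot> x s \<ominus> c \<odot> x t) \<le> (\<bar>c\<bar> + 1) * N (x s \<ominus> x t) + e" for s t
    using car by (simp add: smult_minus N_smult algebra_simps add_nonneg_nonneg)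
  then show "\<exists>y C. ap_fun y \<and> 0 < C \<and> (\<forall>s t. N (c \<odot> x s \<ominus> c \<odot> x t) \<le> C * N (y s \<ominus> y t) + e)"
    using assms by (intro exI[of _ x] exI[of _ "\<bar>c\<bar> + 1"]) auto
qed

lemma ap_fun_zero: "ap_fun (\<lambda>t. \<zero>)"
proof -
  have "\<exists>l>0. \<forall>\<alpha>::real. \<exists>\<tau>\<in>{\<alpha>..\<alpha> + l}. True"
    by (intro exI[of _ 1] conjI allI bexI[of _ \<alpha> for \<alpha>]) auto
  then show ?thesis
    by (simp add: ap_fun_def ap_semimetric_def semimetric_def a_minus_def r_neg)
qed

lemma ap_fun_radial:
  assumes "ap_fun x" "0 \<le> c"
  shows "ap_fun (\<lambda>t. radial c (x t))"
proof (rule ap_fun_approx)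
  have car: "x t \<in> carrier V" for t using assms by (simp add: ap_fun_def)
  then show "radial c (x t) \<in> carrier V" for t by simp
  fix e :: real assume "0 < e"
  then have "N (radial c (x s) \<ominus> radial c (x t)) \<le> 2 * N (x s \<ominus> x t) + e" for s t
    using radial_Lipschitz[OF car car \<open>0 \<le> c\<close>, of s t] by linarith
  then show "\<exists>y C. ap_fun y \<and> 0 < C \<and>
      (\<forall>s t. N (radial c (x s) \<ominus> radial c (x t)) \<le> C * N (y s \<ominus> y t) + e)"
    using assms by (intro exI[of _ x] exI[of _ 2]) auto
qed

text \<open>Besides multiples and uniform limits, this domination criterion handles the corrected
  ergodic part in \<open>bounded_decomposition\<close>, which is compared with the original
  one.\<close>

lemma ergodic_fun_approx:
  assumes \<mu>: "\<mu> \<in> measures_M" and x: "cont_fun x"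
    and approx: "\<And>\<epsilon>. 0 < \<epsilon> \<Longrightarrow> \<exists>z C. ergodic_fun \<mu> z \<and> 0 \<le> C \<and> (\<forall>t. N (x t) \<le> C * N (z t) + \<epsilon>)"
  shows "ergodic_fun \<mu> x"
  unfolding ergodic_fun_def
proof (intro conjI x)
  have nn: "0 \<le> N (x t)" for t using x by (simp add: cont_fun_def N_nonneg)
  obtain z C where z: "ergodic_fun \<mu> z" "0 \<le> C" "\<And>t. N (x t) \<le> C * N (z t) + 1"
    using approx[of 1] by auto
  then obtain B where "\<And>t. N (z t) \<le> B" by (auto simp: ergodic_fun_def)
  then have "N (x t) \<le> C * B + 1" for t
    using z(3)[of t] mult_left_mono[OF _ z(2), of "N (z t)" B] by fastforce
  then show "\<exists>B. \<forall>t. N (x t) \<le> B" by blast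
  show "(mean_value \<mu> (\<lambda>t. (N (x t))\<^sup>2) \<longlongrightarrow> 0) at_top"
  proof (rule mean_value_tendsto_zero[OF \<mu>])
    fix e :: real assume "0 < e"
    \<comment> \<open>The slack \<open>sqrt (e / 2)\<close> becomes exactly \<open>e\<close> through
      (p + q)^2 <= 2 p^2 + 2 q^2.\<close>
    then obtain z C where z: "ergodic_fun \<mu> z" "\<And>t. N (x t) \<le> C * N (z t) + sqrt (e / 2)"
      using approx[of "sqrt (e / 2)"] by auto
    have "(N (x t))\<^sup>2 \<le> 2 * C\<^sup>2 * (N (z t))\<^sup>2 + e" for t
    proof -
      have "(N (x t))\<^sup>2 \<le> (C * N (z t) + sqrt (e / 2))\<^sup>2"
        using z(2) nn by (intro power_mono) auto
      also have "\<dots> \<le> 2 * (C * N (z t))\<^sup>2 + 2 * (sqrt (e / 2))\<^sup>2"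
        using zero_le_power2[of "C * N (z t) - sqrt (e / 2)"] by (simp add: power2_eq_square algebra_simps)
      finally show ?thesis using \<open>0 < e\<close> by (simp add: power_mult_distrib)
    qed
    moreover have "continuous_on UNIV (\<lambda>t. (N (z t))\<^sup>2)"
      using z(1) by (intro continuous_intros continuous_on_N) (simp add: ergodic_fun_def)
    ultimately show "\<exists>g C. continuous_on UNIV g \<and> (mean_value \<mu> g \<longlongrightarrow> 0) at_top \<and>
        (\<forall>t. (N (x t))\<^sup>2 \<le> C * g t + e)"
      using z(1) unfolding ergodic_fun_def by blast
  qed (auto intro!: continuous_intros continuous_on_N x)
qed

lemma ergodic_fun_add:
  assumes \<mu>: "\<mu> \<in> measures_M" and "ergodic_fun \<mu> x" "ergodic_fun \<mu> y"
  shows "ergodic_fun \<mu> (\<lambda>t. x t \<oplus> y t)"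
proof -
  have car: "x t \<in> carrier V" "y t \<in> carrier V" for t
    using assms by (auto simp: ergodic_fun_def cont_fun_def)
  obtain A B where A: "\<And>t. N (x t) \<le> A" and B: "\<And>t. N (y t) \<le> B"
    using assms unfolding ergodic_fun_def by blast
  have cont: "cont_fun (\<lambda>t. x t \<oplus> y t)"
    using assms by (intro cont_fun_add) (auto simp: ergodic_fun_def)
  have N_le: "N (x t \<oplus> y t) \<le> N (x t) + N (y t)" for t
    using car by (intro N_triangle) auto
  have "N (x t \<oplus> y t) \<le> A + B" for t
    using N_le[of t] A[of t] B[of t] by linarith
  moreover have "(mean_value \<mu> (\<lambda>t. (N (x t \<oplus> y t))\<^sup>2) \<longlongrightarrow> 0) at_top"
  proof (rule mean_value_tendsto_zero[OF \<mu>])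
    let ?g = "\<lambda>t. 2 * (N (x t))\<^sup>2 + 2 * (N (y t))\<^sup>2"
    have cxy: "continuous_on UNIV (\<lambda>t. (N (x t))\<^sup>2)" "continuous_on UNIV (\<lambda>t. (N (y t))\<^sup>2)"
      using assms by (simp_all add: ergodic_fun_def continuous_on_power continuous_on_N)
    have "mean_value \<mu> ?g = (\<lambda>r. 2 * mean_value \<mu> (\<lambda>t. (N (x t))\<^sup>2) r + 2 * mean_value \<mu> (\<lambda>t. (N (y t))\<^sup>2) r)"
      using mean_value_linear[OF \<mu> cxy] by blast
    moreover have "((\<lambda>r. 2 * mean_value \<mu> (\<lambda>t. (N (x t))\<^sup>2) r + 2 * mean_value \<mu> (\<lambda>t. (N (y t))\<^sup>2) r)
        \<longlongrightarrow> 2 * 0 + 2 * 0) at_top"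
      using assms by (intro tendsto_intros) (auto simp: ergodic_fun_def)
    ultimately have lim: "(mean_value \<mu> ?g \<longlongrightarrow> 0) at_top" by simp
    fix e :: real assume "0 < e"
    have "(N (x t \<oplus> y t))\<^sup>2 \<le> 1 * ?g t + e" for t
    proof -
      have "(N (x t \<oplus> y t))\<^sup>2 \<le> (N (x t) + N (y t))\<^sup>2"
        using N_le car by (intro power_mono) (auto simp: N_nonneg)
      also have "\<dots> \<le> ?g t"
        using zero_le_power2[of "N (x t) - N (y t)"] by (simp add: power2_eq_square algebra_simps)
      finally show ?thesis using \<open>0 < e\<close> by simp
    qed
    moreover have "continuous_on UNIV ?g" using cxy by (intro continuous_on_add continuous_on_mult_left)
    ultimately show "\<exists>g C. continuous_on UNIV g \<and> (mean_value \<mu> g \<longlongrightarrow> 0) at_top \<and>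
        (\<forall>t. (N (x t \<oplus> y t))\<^sup>2 \<le> C * g t + e)"
      using lim by blast
  qed (auto intro!: continuous_intros continuous_on_N cont)
  ultimately show ?thesis
    using cont by (auto simp: ergodic_fun_def)
qed

lemma ergodic_fun_smult:
  assumes \<mu>: "\<mu> \<in> measures_M" and x: "ergodic_fun \<mu> x"
  shows "ergodic_fun \<mu> (\<lambda>t. c \<odot> x t)"
proof (rule ergodic_fun_approx[OF \<mu>])
  have car: "x t \<in> carrier V" for t using x by (simp add: ergodic_fun_def cont_fun_def)
  show "cont_fun (\<lambda>t. c \<odot> x t)"
  proof (rule cont_fun_approx)
    fix e :: real assume "0 < e"
    then have "N (c \<odot> x s \<ominus> c \<odot> x t) \<le> \<bar>c\<bar> * N (x s \<ominus> x t) + e" for s t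
      using car by (simp add: smult_minus N_smult)
    then show "\<exists>y C. cont_fun y \<and> (\<forall>s t. N (c \<odot> x s \<ominus> c \<odot> x t) \<le> C * N (y s \<ominus> y t) + e)"
      using x unfolding ergodic_fun_def by blast
  qed (use car in auto)
  fix e :: real assume "0 < e"
  then have "N (c \<odot> x t) \<le> \<bar>c\<bar> * N (x t) + e" for t using car by (simp add: N_smult)
  then show "\<exists>z C. ergodic_fun \<mu> z \<and> 0 \<le> C \<and> (\<forall>t. N (c \<odot> x t) \<le> C * N (z t) + e)"
    using x abs_ge_zero by blast
qed

lemma ergodic_fun_zero: "ergodic_fun \<mu> (\<lambda>t. \<zero>)"
proof -
  have "mean_value \<mu> (\<lambda>t. 0) = (\<lambda>r. 0)"
    by (simp add: mean_value_def set_lebesgue_integral_def fun_eq_iff)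
  then show ?thesis
    by (auto simp: ergodic_fun_def cont_fun_def a_minus_def r_neg)
qed

lemma ap_fun_uniform_limit:
  assumes "\<And>n :: nat. ap_fun (y n)" "\<And>t. x t \<in> carrier V" "\<And>n t. N (y n t \<ominus> x t) \<le> b n" "b \<longlonglongrightarrow> 0"
  shows "ap_fun x"
proof (rule ap_fun_approx[OF assms(2)])
  fix e :: real assume "0 < e"
  then obtain n where n: "b n < e / 2"
    using order_tendstoD(2)[OF assms(4), of "e/2"] by (auto simp: eventually_sequentially)
  have car: "y n t \<in> carrier V" for t using assms(1)[of n] by (simp add: ap_fun_def)
  have "N (x s \<ominus> x t) \<le> 1 * N (y n s \<ominus> y n t) + e" for s t
    using N_triangle_minus[of "x s" "x t" "y n s"] N_triangle_minus[of "y n s" "x t" "y n t"]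
      N_minus_commute[of "x s" "y n s"] assms(2)[of s] assms(2)[of t] assms(3)[of n s] assms(3)[of n t] car n
    by auto
  then show "\<exists>y C. ap_fun y \<and> 0 < C \<and> (\<forall>s t. N (x s \<ominus> x t) \<le> C * N (y s \<ominus> y t) + e)"
    using assms(1) zero_less_one by blast
qed

lemma ergodic_fun_uniform_limit:
  assumes \<mu>: "\<mu> \<in> measures_M"
    and "\<And>n :: nat. ergodic_fun \<mu> (z n)" "\<And>t. x t \<in> carrier V" "\<And>n t. N (z n t \<ominus> x t) \<le> b n" "b \<longlonglongrightarrow> 0"
  shows "ergodic_fun \<mu> x"
proof (rule ergodic_fun_approx[OF \<mu>])
  have car: "z n t \<in> carrier V" for n t using assms(2)[of n] by (simp add: ergodic_fun_def cont_fun_def)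
  have small: "\<exists>n. b n < e" if "0 < e" for e
    using order_tendstoD(2)[OF assms(5) that] by (auto simp: eventually_sequentially)
  show "cont_fun x"
  proof (rule cont_fun_approx[OF assms(3)])
    fix e :: real assume "0 < e"
    then obtain n where n: "b n < e / 2" using small[of "e/2"] by auto
    have "N (x s \<ominus> x t) \<le> 1 * N (z n s \<ominus> z n t) + e" for s t
      using N_triangle_minus[of "x s" "x t" "z n s"] N_triangle_minus[of "z n s" "x t" "z n t"]
        N_minus_commute[of "x s" "z n s"] assms(3)[of s] assms(3)[of t] assms(4)[of n s] assms(4)[of n t] car n
      by auto
    then show "\<exists>y C. cont_fun y \<and> (\<forall>s t. N (x s \<ominus> x t) \<le> C * N (y s \<ominus> y t) + e)"
      using assms(2) unfolding ergodic_fun_def by blast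
  qed
  fix e :: real assume "0 < e"
  then obtain n where n: "b n < e" using small by auto
  have "N (x t) \<le> 1 * N (z n t) + e" for t
    using N_le_add_minus[of "x t" "z n t"] N_minus_commute[of "x t" "z n t"] assms(3)[of t] assms(4)[of n t] car n
    by auto
  then show "\<exists>z C. ergodic_fun \<mu> z \<and> 0 \<le> C \<and> (\<forall>t. N (x t) \<le> C * N (z t) + e)"
    using assms(2) zero_le_one by blast
qed

lemma bounded_decomposition:
  assumes \<mu>: "\<mu> \<in> measures_M" and y: "ap_fun y" and z: "ergodic_fun \<mu> z"
    and c: "0 \<le> c" "\<And>t. N (y t \<oplus> z t) \<le> c"
  obtains y' z' where "ap_fun y'" "ergodic_fun \<mu> z'" "\<And>t. y t \<oplus> z t = y' t \<oplus> z' t"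
    "\<And>t. N (y' t) \<le> c" "\<And>t. N (z' t) \<le> 2 * c"
proof
  have car [simp]: "y t \<in> carrier V" "z t \<in> carrier V" for t
    using y z by (auto simp: ap_fun_def ergodic_fun_def cont_fun_def)
  define y' where "y' t = radial c (y t)" for t
  define z' where "z' t = (y t \<ominus> y' t) \<oplus> z t" for t
  have car' [simp]: "y' t \<in> carrier V" for t by (simp add: y'_def)
  show ap: "ap_fun y'" unfolding y'_def by (rule ap_fun_radial[OF y c(1)])
  have N_diff: "N (y t \<ominus> y' t) \<le> N (z t)" for t
  proof -
    have "y t = (y t \<oplus> z t) \<ominus> z t"
      by (simp add: a_minus_def a_assoc r_neg)
    then have "N (y t) \<le> c + N (z t)"
      using N_minus_le[of "y t \<oplus> z t" "z t"] c(2)[of t] by simp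
    then show ?thesis
      unfolding y'_def using N_minus_radial[OF car(1) c(1)] by (simp add: N_nonneg)
  qed
  have "cont_fun (\<lambda>t. y t \<ominus> y' t)"
    using cont_fun_add[OF ap_fun_imp_cont_fun[OF y] ap_fun_imp_cont_fun[OF ap_fun_smult[OF ap, of "-1"]]]
    by (simp add: a_minus_def minus_eq_smult)
  then have "cont_fun z'"
    unfolding z'_def using z by (intro cont_fun_add) (auto simp: ergodic_fun_def)
  then show "ergodic_fun \<mu> z'"
  proof (rule ergodic_fun_approx[OF \<mu>])
    fix e :: real assume "0 < e"
    \<comment> \<open>One \<open>N (z t)\<close> stands for \<open>z\<close> itself and one for the
      part of \<open>y\<close> that was cut off. This gives ergodicity, but no bound in terms of
      \<open>c\<close>.\<close>
    then have "N (z' t) \<le> 2 * N (z t) + e" for t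
      using N_triangle[of "y t \<ominus> y' t" "z t"] N_diff[of t] by (simp add: z'_def)
    then show "\<exists>z C. ergodic_fun \<mu> z \<and> 0 \<le> C \<and> (\<forall>t. N (z' t) \<le> C * N (z t) + e)"
      using z by (intro exI[of _ z] exI[of _ 2]) auto
  qed
  show "N (y' t) \<le> c" for t
    unfolding y'_def by (rule N_radial_le) (use c in auto)
  show eq: "y t \<oplus> z t = y' t \<oplus> z' t" for t
  proof -
    have "y' t \<oplus> z' t = ((y t \<ominus> y' t) \<oplus> y' t) \<oplus> z t"
      by (simp add: z'_def a_ac)
    then show ?thesis by (simp add: minus_add_cancel_right)
  qed
  \<comment> \<open>Read as the whole function minus \<open>y'\<close>, the same \<open>z'\<close>
    has the second estimate \<open>c + c\<close>, independent of \<open>z\<close>.\<close>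
  have "z' t = (y t \<oplus> z t) \<ominus> y' t" for t
    by (simp add: z'_def a_minus_def a_ac)
  then show "N (z' t) \<le> 2 * c" for t
    using N_minus_le[of "y t \<oplus> z t" "y' t"] c(2)[of t] \<open>N (y' t) \<le> c\<close> by simp
qed

section \<open>The normed space of pseudo almost periodic functions\<close>

definition pap_space :: "real measure \<Rightarrow> (real, real \<Rightarrow> 'v) module" where
  "pap_space \<mu> = \<lparr>carrier = {x. pap_fun \<mu> x}, mult = undefined, one = undefined,
     zero = (\<lambda>t. \<zero>), add = (\<lambda>x y t. x t \<oplus> y t), smult = (\<lambda>c x t. c \<odot> x t)\<rparr>"

definition sup_N :: "(real \<Rightarrow> 'v) \<Rightarrow> real" where
  "sup_N x = (SUP t. N (x t))"

lemma pap_fun_closed: "pap_fun \<mu> x \<Longrightarrow> x t \<in> carrier V"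
  by (auto simp: pap_fun_def ap_fun_def ergodic_fun_def cont_fun_def)

lemma pap_fun_cont_fun: "pap_fun \<mu> x \<Longrightarrow> cont_fun x"
  unfolding pap_fun_def
  by (metis (no_types, lifting) cont_fun_add ap_fun_imp_cont_fun ergodic_fun_def ext)

lemma pap_fun_bdd_above:
  assumes "pap_fun \<mu> x"
  shows "bdd_above (range (\<lambda>t. N (x t)))"
proof -
  obtain y z where yz: "ap_fun y" "ergodic_fun \<mu> z" "\<And>t. x t = y t \<oplus> z t"
    using assms unfolding pap_fun_def by blast
  obtain A where A: "\<And>t. N (y t) \<le> A" using ap_fun_bounded[OF yz(1)] by blast
  obtain B where B: "\<And>t. N (z t) \<le> B" using yz(2) unfolding ergodic_fun_def by blast
  have "N (x t) \<le> A + B" for t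
    using N_triangle[of "y t" "z t"] A[of t] B[of t] yz by (simp add: ap_fun_def ergodic_fun_def cont_fun_def)
  then show ?thesis by (auto intro!: bdd_aboveI)
qed

lemma N_le_sup_N: "pap_fun \<mu> x \<Longrightarrow> N (x t) \<le> sup_N x"
  unfolding sup_N_def by (rule cSUP_upper[OF UNIV_I pap_fun_bdd_above])

lemma sup_N_le: "(\<And>t. N (x t) \<le> B) \<Longrightarrow> sup_N x \<le> B"
  unfolding sup_N_def by (rule cSUP_least) auto

lemma pap_fun_add:
  assumes \<mu>: "\<mu> \<in> measures_M" and "pap_fun \<mu> x" "pap_fun \<mu> x'"
  shows "pap_fun \<mu> (\<lambda>t. x t \<oplus> x' t)"
proof -
  obtain y z where yz: "ap_fun y" "ergodic_fun \<mu> z" "\<And>t. x t = y t \<oplus> z t"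
    using assms unfolding pap_fun_def by blast
  obtain y' z' where yz': "ap_fun y'" "ergodic_fun \<mu> z'" "\<And>t. x' t = y' t \<oplus> z' t"
    using assms unfolding pap_fun_def by blast
  have "y t \<in> carrier V" "y' t \<in> carrier V" "z t \<in> carrier V" "z' t \<in> carrier V" for t
    using yz yz' by (auto simp: ap_fun_def ergodic_fun_def cont_fun_def)
  then have "x t \<oplus> x' t = (y t \<oplus> y' t) \<oplus> (z t \<oplus> z' t)" for t
    by (simp add: yz(3) yz'(3) a_ac)
  then show ?thesis
    unfolding pap_fun_def
    by (intro exI[of _ "\<lambda>t. y t \<oplus> y' t"] exI[of _ "\<lambda>t. z t \<oplus> z' t"])
      (use yz yz' in \<open>auto intro: ap_fun_add ergodic_fun_add[OF \<mu>]\<close>)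
qed

lemma pap_fun_smult:
  assumes \<mu>: "\<mu> \<in> measures_M" and "pap_fun \<mu> x"
  shows "pap_fun \<mu> (\<lambda>t. c \<odot> x t)"
proof -
  obtain y z where yz: "ap_fun y" "ergodic_fun \<mu> z" "\<And>t. x t = y t \<oplus> z t"
    using assms unfolding pap_fun_def by blast
  have "y t \<in> carrier V" "z t \<in> carrier V" for t
    using yz by (auto simp: ap_fun_def ergodic_fun_def cont_fun_def)
  then have "c \<odot> x t = c \<odot> y t \<oplus> c \<odot> z t" for t
    by (simp add: yz(3) smult_r_distr)
  then show ?thesis
    unfolding pap_fun_def
    by (intro exI[of _ "\<lambda>t. c \<odot> y t"] exI[of _ "\<lambda>t. c \<odot> z t"])
      (use yz in \<open>auto intro: ap_fun_smult ergodic_fun_smult[OF \<mu>]\<close>)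
qed

lemma pap_fun_zero: "pap_fun \<mu> (\<lambda>t. \<zero>)"
  unfolding pap_fun_def
  by (intro exI[of _ "\<lambda>t. \<zero>"]) (auto intro: ap_fun_zero ergodic_fun_zero)

lemma module_pap_space:
  assumes \<mu>: "\<mu> \<in> measures_M"
  shows "Module.module real_field (pap_space \<mu>)"
proof (rule moduleI)
  show "cring real_field" by (rule cring_real_field)
  show "abelian_group (pap_space \<mu>)"
  proof (rule abelian_groupI)
    fix x assume x: "x \<in> carrier (pap_space \<mu>)"
    then have "(\<lambda>t. (-1) \<odot> x t) \<in> carrier (pap_space \<mu>)"
      by (simp add: pap_space_def pap_fun_smult[OF \<mu>])
    moreover have "(-1) \<odot> x t \<oplus> x t = \<zero>" for t
      using x pap_fun_closed[of \<mu> x t] by (simp add: pap_space_def l_neg flip: minus_eq_smult)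
    ultimately show "\<exists>y\<in>carrier (pap_space \<mu>). y \<oplus>\<^bsub>pap_space \<mu>\<^esub> x = \<zero>\<^bsub>pap_space \<mu>\<^esub>"
      by (intro bexI) (auto simp: pap_space_def)
  qed (auto simp: pap_space_def fun_eq_iff pap_fun_zero dest: pap_fun_closed
      intro: pap_fun_add[OF \<mu>] a_assoc a_comm l_zero)
qed (auto simp: pap_space_def fun_eq_iff dest: pap_fun_closed
      intro: pap_fun_smult[OF \<mu>] smult_l_distr[simplified] smult_r_distr[simplified] smult_assoc1[simplified]
        smult_one[simplified])

text \<open>Subtraction in a record goes through the additive inverse selected within the carrier.
  That it is pointwise follows from uniqueness of inverses, once the pointwise negative is known to
  be pseudo almost periodic.\<close>

lemma pap_space_minus:
  assumes \<mu>: "\<mu> \<in> measures_M" and "x \<in> carrier (pap_space \<mu>)" "y \<in> carrier (pap_space \<mu>)"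
  shows "x \<ominus>\<^bsub>pap_space \<mu>\<^esub> y = (\<lambda>t. x t \<ominus> y t)"
proof -
  interpret W: abelian_group "pap_space \<mu>"
    using module_pap_space[OF \<mu>] by (simp add: Module.module_def)
  have y: "pap_fun \<mu> y" using assms by (simp add: pap_space_def)
  have "(\<lambda>t. (-1) \<odot> y t) \<in> carrier (pap_space \<mu>)"
    by (simp add: pap_space_def pap_fun_smult[OF \<mu> y])
  moreover have "(-1) \<odot> y t \<oplus> y t = \<zero>" for t
    using pap_fun_closed[OF y] by (simp add: l_neg flip: minus_eq_smult)
  ultimately have "\<ominus>\<^bsub>pap_space \<mu>\<^esub> y = (\<lambda>t. (-1) \<odot> y t)"
    using assms(3) by (intro W.minus_equality) (auto simp: pap_space_def)
  then show ?thesis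
    using pap_fun_closed[OF y] by (simp add: a_minus_def[of "pap_space \<mu>"] pap_space_def a_minus_def minus_eq_smult)
qed

lemma normed_space_on_pap_space:
  assumes \<mu>: "\<mu> \<in> measures_M"
  shows "normed_space_on (pap_space \<mu>) sup_N"
proof (intro normed_space_on.intro normed_space_on_axioms.intro module_pap_space[OF \<mu>])
  fix x assume "x \<in> carrier (pap_space \<mu>)"
  then have x: "pap_fun \<mu> x" by (simp add: pap_space_def)
  have car: "x t \<in> carrier V" for t using x by (rule pap_fun_closed)
  show nn: "0 \<le> sup_N x"
    using N_le_sup_N[OF x, of 0] N_nonneg[OF car, of 0] by linarith
  show "(sup_N x = 0) = (x = \<zero>\<^bsub>pap_space \<mu>\<^esub>)"
  proof
    assume "sup_N x = 0"
    then have "N (x t) = 0" for t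
      using N_le_sup_N[OF x, of t] N_nonneg[OF car, of t] by linarith
    then show "x = \<zero>\<^bsub>pap_space \<mu>\<^esub>"
      using N_eq_0_iff[OF car] by (simp add: pap_space_def fun_eq_iff)
  qed (simp add: pap_space_def sup_N_def)
  show "sup_N (c \<odot>\<^bsub>pap_space \<mu>\<^esub> x) = \<bar>c\<bar> * sup_N x" for c
  proof (rule antisym)
    show "sup_N (c \<odot>\<^bsub>pap_space \<mu>\<^esub> x) \<le> \<bar>c\<bar> * sup_N x"
      by (rule sup_N_le) (auto simp: pap_space_def N_smult[OF car] intro: mult_left_mono N_le_sup_N[OF x])
    have "pap_fun \<mu> (\<lambda>t. c \<odot> x t)" by (rule pap_fun_smult[OF \<mu> x])
    then have le: "\<bar>c\<bar> * N (x t) \<le> sup_N (\<lambda>t. c \<odot> x t)" for t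
      using N_le_sup_N[of \<mu> "\<lambda>t. c \<odot> x t" t] by (simp add: N_smult[OF car])
    show "\<bar>c\<bar> * sup_N x \<le> sup_N (c \<odot>\<^bsub>pap_space \<mu>\<^esub> x)"
    proof (cases "c = 0")
      case True
      then show ?thesis using le[of 0] by (simp add: pap_space_def)
    next
      case False
      then have "sup_N x \<le> sup_N (\<lambda>t. c \<odot> x t) / \<bar>c\<bar>"
        using le by (intro sup_N_le) (simp add: field_simps)
      then show ?thesis using False by (simp add: pap_space_def field_simps)
    qed
  qed
  fix y assume "y \<in> carrier (pap_space \<mu>)"
  then have y: "pap_fun \<mu> y" by (simp add: pap_space_def)
  have "N (x t \<oplus> y t) \<le> sup_N x + sup_N y" for t
    using N_triangle[OF car pap_fun_closed[OF y], of t t] N_le_sup_N[OF x, of t] N_le_sup_N[OF y, of t] by linarith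
  then show "sup_N (x \<oplus>\<^bsub>pap_space \<mu>\<^esub> y) \<le> sup_N x + sup_N y"
    by (intro sup_N_le) (simp add: pap_space_def)
qed

end

text \<open>The explicit rate is the purpose: used at every t with the same \<open>C\<close>, it
  turns pointwise limits into uniform ones.\<close>

lemma (in banach_space_on) fast_Cauchy_limit:
  assumes u: "\<And>n. u n \<in> carrier V" and fast: "\<And>n. N (u (Suc n) \<ominus> u n) \<le> C * (1/2) ^ n"
  obtains l where "l \<in> carrier V" "\<And>n. N (u n \<ominus> l) \<le> 2 * C * (1/2) ^ n"
proof -
  note le = fast_Cauchy_dist_le[of u C, OF u fast]
  have "\<exists>n0. \<forall>m\<ge>n0. \<forall>n\<ge>n0. N (u m \<ominus> u n) < e" if "0 < e" for e
  proof -
    \<comment> \<open>Both indices are compared with \<open>n0\<close>, at cost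
      \<open>2 * C * (1/2) ^ n0\<close> each.\<close>
    have "(\<lambda>n. 4 * C * (1/2) ^ n) \<longlonglongrightarrow> 4 * C * 0"
      by (intro tendsto_intros) auto
    then have "\<forall>\<^sub>F n in sequentially. 4 * C * (1/2) ^ n < e"
      by (rule order_tendstoD) (use that in simp)
    then obtain n0 where n0: "4 * C * (1/2) ^ n0 < e"
      by (rule eventually_happens'[OF sequentially_bot, THEN exE])
    have "N (u m \<ominus> u n) < e" if "n0 \<le> m" "n0 \<le> n" for m n
      using N_triangle_minus[OF u u u, of m n n0] N_minus_commute[OF u u, of n n0] le[OF that(1)] le[OF that(2)] n0
      by linarith
    then show ?thesis by blast
  qed
  then obtain l where l: "l \<in> carrier V" "(\<lambda>n. N (u n \<ominus> l)) \<longlonglongrightarrow> 0"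
    using complete[of u] u by blast
  have "N (u n \<ominus> l) \<le> 2 * C * (1/2) ^ n" for n
  proof (rule LIMSEQ_le_const)
    show "(\<lambda>m. 2 * C * (1/2) ^ n + N (u m \<ominus> l)) \<longlonglongrightarrow> 2 * C * (1/2) ^ n"
      using tendsto_add[OF tendsto_const l(2)] by simp
    have "N (u n \<ominus> l) \<le> 2 * C * (1/2) ^ n + N (u m \<ominus> l)" if "n \<le> m" for m
      using N_triangle_minus[OF u l(1) u, of n m] N_minus_commute[OF u u, of n m] le[OF that] by linarith
    then show "\<exists>k. \<forall>m\<ge>k. N (u n \<ominus> l) \<le> 2 * C * (1/2) ^ n + N (u m \<ominus> l)" by blast
  qed
  then show ?thesis using that l(1) by blast
qed

theorem (in banach_space_on) banach_space_on_pap_space: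
  assumes \<mu>: "\<mu> \<in> measures_M"
  shows "banach_space_on (pap_space \<mu>) sup_N"
proof -
  interpret W: normed_space_on "pap_space \<mu>" sup_N
    by (rule normed_space_on_pap_space[OF \<mu>])
  show ?thesis
  proof (rule W.banach_space_on_if_fast_Cauchy_converges)
    fix u assume u: "\<And>n. u n \<in> carrier (pap_space \<mu>)"
      and fast: "\<And>n. sup_N (u (Suc n) \<ominus>\<^bsub>pap_space \<mu>\<^esub> u n) \<le> (1/2) ^ n"
    define decomp where "decomp n p \<longleftrightarrow> ap_fun (fst p) \<and> ergodic_fun \<mu> (snd p) \<and>
      (\<forall>t. u n t = fst p t \<oplus> snd p t)" for n p
    define near where "near n p q \<longleftrightarrow> (\<forall>t. N (fst q t \<ominus> fst p t) \<le> (1/2) ^ n \<and>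
      N (snd q t \<ominus> snd p t) \<le> 2 * (1/2) ^ n)" for n :: nat and p q :: "(real \<Rightarrow> 'a) \<times> (real \<Rightarrow> 'a)"
    have pap: "pap_fun \<mu> (u n)" for n using u[of n] by (simp add: pap_space_def)
    \<comment> \<open>Dependent choice is essential: the decomposition of \<open>u (Suc n)\<close>
      must extend the one chosen for \<open>u n\<close> by a bounded decomposition of the increment,
      otherwise \<open>near\<close> could fail.\<close>
    have "\<exists>p. \<forall>n. decomp n (p n) \<and> near n (p n) (p (Suc n))"
    proof (rule dependent_nat_choice)
      show "\<exists>p. decomp 0 p"
        using pap[of 0] unfolding pap_fun_def decomp_def by auto
      fix p n assume "decomp n p"
      then obtain y z where p: "p = (y, z)" and yz: "ap_fun y" "ergodic_fun \<mu> z" "\<And>t. u n t = y t \<oplus> z t"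
        unfolding decomp_def by (cases p) auto
      have car: "y t \<in> carrier V" "z t \<in> carrier V" for t
        using yz by (auto simp: ap_fun_def ergodic_fun_def cont_fun_def)
      define x where "x = u (Suc n) \<ominus>\<^bsub>pap_space \<mu>\<^esub> u n"
      have x_eq: "x t = u (Suc n) t \<ominus> u n t" for t
        unfolding x_def pap_space_minus[OF \<mu> u u] ..
      have x: "pap_fun \<mu> x"
        using W.minus_closed[OF u u, of "Suc n" n] by (simp add: x_def pap_space_def)
      obtain a b where ab: "ap_fun a" "ergodic_fun \<mu> b" "\<And>t. x t = a t \<oplus> b t"
        using x unfolding pap_fun_def by blast
      have "N (a t \<oplus> b t) \<le> (1/2) ^ n" for t
        using N_le_sup_N[OF x, of t] fast[of n] by (simp add: x_def[symmetric] ab(3)[symmetric])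
      then obtain a' b' where ab': "ap_fun a'" "ergodic_fun \<mu> b'" "\<And>t. a t \<oplus> b t = a' t \<oplus> b' t"
        "\<And>t. N (a' t) \<le> (1/2) ^ n" "\<And>t. N (b' t) \<le> 2 * (1/2) ^ n"
        using bounded_decomposition[OF \<mu> ab(1,2), of "(1/2) ^ n"] by auto
      have car': "a' t \<in> carrier V" "b' t \<in> carrier V" for t
        using ab' by (auto simp: ap_fun_def ergodic_fun_def cont_fun_def)
      have "u (Suc n) t = (a' t \<oplus> y t) \<oplus> (b' t \<oplus> z t)" for t
      proof -
        have "u (Suc n) t = x t \<oplus> u n t"
          unfolding x_eq using minus_add_cancel_right pap pap_fun_closed by metis
        then show ?thesis
          using car car' by (simp add: ab(3) ab'(3) yz(3) a_ac)
      qed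
      moreover have "(a' t \<oplus> y t) \<ominus> y t = a' t" "(b' t \<oplus> z t) \<ominus> z t = b' t" for t
        using car car' by (simp_all add: a_minus_def a_assoc r_neg)
      ultimately show "\<exists>q. decomp (Suc n) q \<and> near n p q"
        using ab' yz unfolding decomp_def near_def p
        by (intro exI[of _ "(\<lambda>t. a' t \<oplus> y t, \<lambda>t. b' t \<oplus> z t)"])
          (auto intro: ap_fun_add ergodic_fun_add[OF \<mu>])
    qed
    then obtain p where p: "\<And>n. decomp n (p n)" "\<And>n. near n (p n) (p (Suc n))" by blast
    define y z where "y n = fst (p n)" and "z n = snd (p n)" for n
    have yz: "ap_fun (y n)" "ergodic_fun \<mu> (z n)" "u n t = y n t \<oplus> z n t" for n t
      using p(1)[of n] by (auto simp: decomp_def y_def z_def)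
    have car: "y n t \<in> carrier V" "z n t \<in> carrier V" for n t
      using yz(1,2)[of n] by (auto simp: ap_fun_def ergodic_fun_def cont_fun_def)
    have "\<exists>l. l \<in> carrier V \<and> (\<forall>n. N (y n t \<ominus> l) \<le> 2 * 1 * (1/2) ^ n)" for t
    proof -
      have "N (y (Suc n) t \<ominus> y n t) \<le> 1 * (1/2) ^ n" for n
        using p(2)[of n] by (simp add: near_def y_def)
      then show ?thesis
        using fast_Cauchy_limit[of "\<lambda>n. y n t" 1] car by metis
    qed
    then obtain y' where y': "\<And>t. y' t \<in> carrier V" "\<And>n t. N (y n t \<ominus> y' t) \<le> 2 * 1 * (1/2) ^ n" by metis
    have "\<exists>l. l \<in> carrier V \<and> (\<forall>n. N (z n t \<ominus> l) \<le> 2 * 2 * (1/2) ^ n)" for t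
    proof -
      have "N (z (Suc n) t \<ominus> z n t) \<le> 2 * (1/2) ^ n" for n
        using p(2)[of n] by (simp add: near_def z_def)
      then show ?thesis
        using fast_Cauchy_limit[of "\<lambda>n. z n t" 2] car by metis
    qed
    then obtain z' where z': "\<And>t. z' t \<in> carrier V" "\<And>n t. N (z n t \<ominus> z' t) \<le> 2 * 2 * (1/2) ^ n" by metis
    have null: "(\<lambda>n. c * (1/2) ^ n) \<longlonglongrightarrow> 0" for c :: real
      using tendsto_mult[OF tendsto_const LIMSEQ_power_zero[of "1/2 :: real"], of c] by simp
    have "ap_fun y'"
      using ap_fun_uniform_limit[OF yz(1) y' null] .
    moreover have "ergodic_fun \<mu> z'"
      using ergodic_fun_uniform_limit[OF \<mu> yz(2) z' null] .
    ultimately have l: "(\<lambda>t. y' t \<oplus> z' t) \<in> carrier (pap_space \<mu>)"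
      by (auto simp: pap_space_def pap_fun_def)
    \<comment> \<open>The 6 is \<open>2 * 1\<close> from the almost periodic parts plus
      \<open>2 * 2\<close> from the ergodic ones.\<close>
    have "sup_N (u n \<ominus>\<^bsub>pap_space \<mu>\<^esub> (\<lambda>t. y' t \<oplus> z' t)) \<le> 6 * (1/2) ^ n" for n
    proof (rule sup_N_le)
      fix t
      show "N ((u n \<ominus>\<^bsub>pap_space \<mu>\<^esub> (\<lambda>t. y' t \<oplus> z' t)) t) \<le> 6 * (1/2) ^ n"
        unfolding pap_space_minus[OF \<mu> u l] yz(3)
        using N_add_minus_add_le[OF car y'(1) z'(1), of n t n t t t] y'(2)[of n t] z'(2)[of n t] by linarith
    qed
    then have "(\<lambda>n. sup_N (u n \<ominus>\<^bsub>pap_space \<mu>\<^esub> (\<lambda>t. y' t \<oplus> z' t))) \<longlonglongrightarrow> 0"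
      using W.N_nonneg[OF W.minus_closed[OF u l]]
      by (intro Lim_null_comparison[OF _ null[of 6]]) auto
    then show "\<exists>l\<in>carrier (pap_space \<mu>). (\<lambda>n. sup_N (u n \<ominus>\<^bsub>pap_space \<mu>\<^esub> l)) \<longlonglongrightarrow> 0"
      using l by blast
  qed
qed

section \<open>Strongly measurable functions\<close>

text \<open>The value is a point among \<open>e 0\<close>, ..., \<open>e n\<close> closest to
  \<open>x\<close>. For \<open>e\<close> enumerating a dense subset, it serves to approximate a
  measurable function by simple ones.\<close>

primrec nearest :: "(nat \<Rightarrow> 'a::metric_space) \<Rightarrow> 'a \<Rightarrow> nat \<Rightarrow> 'a" where
  "nearest e x 0 = e 0"
| "nearest e x (Suc n) = (if dist x (e (Suc n)) < dist x (nearest e x n) then e (Suc n) else nearest e x n)"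

lemma dist_nearest_Suc: "dist x (nearest e x (Suc n)) = min (dist x (e (Suc n))) (dist x (nearest e x n))"
  by simp

lemma dist_nearest_le: "k \<le> n \<Longrightarrow> dist x (nearest e x n) \<le> dist x (e k)"
proof (induction n)
  case (Suc n)
  then show ?case
    unfolding dist_nearest_Suc by (cases "k = Suc n") (auto simp: min.coboundedI2)
qed simp

lemma nearest_LIMSEQ:
  assumes "x \<in> closure (range e)"
  shows "nearest e x \<longlonglongrightarrow> x"
proof (rule metric_LIMSEQ_I)
  fix r :: real assume "0 < r"
  then obtain k where "dist (e k) x < r"
    using assms unfolding closure_approachable by blast
  then have "dist (nearest e x n) x < r" if "k \<le> n" for n
    using dist_nearest_le[OF that, of x e] by (simp add: dist_commute)
  then show "\<exists>k. \<forall>n\<ge>k. dist (nearest e x n) x < r" by blast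
qed

text \<open>This is the half of Pettis' measurability theorem that produces simple functions:
  \<open>X w\<close> is replaced by the nearest of the first points of a countable dense
  set.\<close>

lemma random_var_if_separable:
  assumes X: "X \<in> borel_measurable P" and D: "countable D" "\<And>w. w \<in> space P \<Longrightarrow> X w \<in> closure D"
  shows "random_var P X"
proof (cases "D = {}")
  case True
  then have "space P = {}" using D by auto
  then show ?thesis
    unfolding random_var_def by (intro exI[of _ "\<lambda>_ _. 0"]) auto
next
  case False
  let ?e = "from_nat_into D"
  have e: "range ?e = D" using False D(1) by (rule range_from_nat_into)
  have dist: "(\<lambda>w. dist (X w) c) \<in> borel_measurable P" for c
    using measurable_compose[OF X, of "\<lambda>x. dist x c" borel]
    by (simp add: borel_measurable_continuous_onI continuous_intros)
  \<comment> \<open>Measurability of the distance is carried through the induction because the case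
    distinction in \<open>nearest\<close> compares such distances.\<close>
  have "simple_function P (\<lambda>w. nearest ?e (X w) n) \<and>
      (\<lambda>w. dist (X w) (nearest ?e (X w) n)) \<in> borel_measurable P" for n
  proof (induction n)
    case 0
    then show ?case by (simp add: dist)
  next
    case (Suc n)
    then have 1: "(\<lambda>w. dist (X w) (nearest ?e (X w) n)) \<in> borel_measurable P"
      and 2: "simple_function P (\<lambda>w. nearest ?e (X w) n)" by auto
    have "simple_function P (\<lambda>w. nearest ?e (X w) (Suc n))"
      unfolding nearest.simps
      by (intro simple_function_If simple_function_const 2 borel_measurable_less dist 1)
    moreover have "(\<lambda>w. dist (X w) (nearest ?e (X w) (Suc n))) \<in> borel_measurable P"
      unfolding dist_nearest_Suc by (intro borel_measurable_min dist 1)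
    ultimately show ?case by blast
  qed
  then show ?thesis
    unfolding random_var_def
    by (intro exI[of _ "\<lambda>n w. nearest ?e (X w) n"]) (use D(2) in \<open>auto intro: nearest_LIMSEQ simp: e\<close>)
qed

text \<open>A diagonal choice of simple functions need not converge, since the speed depends on
  \<open>w\<close>. Instead, all values of all approximants form a countable set whose closure
  contains the range of the limit, and separability concludes.\<close>

lemma random_var_LIMSEQ:
  assumes X: "\<And>i :: nat. random_var P (X i)" and lim: "\<And>w. w \<in> space P \<Longrightarrow> (\<lambda>i. X i w) \<longlonglongrightarrow> Y w"
  shows "random_var P Y"
proof -
  have "\<forall>i. \<exists>s. (\<forall>j. simple_function P (s j)) \<and> (\<forall>w\<in>space P. (\<lambda>j. s j w) \<longlonglongrightarrow> X i w)"
    using X unfolding random_var_def by blast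
  then obtain s where s: "\<And>i j. simple_function P (s i j)"
    "\<And>i w. w \<in> space P \<Longrightarrow> (\<lambda>j. s i j w) \<longlonglongrightarrow> X i w"
    by metis
  define D where "D = (\<Union>i j :: nat. s i j ` space P)"
  have "X i w \<in> closure D" if "w \<in> space P" for i w
    by (rule closed_sequentially[OF closed_closure _ s(2)[OF that]])
      (use that closure_subset in \<open>force simp: D_def\<close>)
  then have "Y w \<in> closure D" if "w \<in> space P" for w
    by (rule closed_sequentially[OF closed_closure _ lim[OF that]]) (use that in auto)
  moreover have "countable D"
    unfolding D_def using s(1) by (intro countable_UN countableI_type countable_finite simple_functionD(1))
  moreover have "Y \<in> borel_measurable P"
    by (rule borel_measurable_LIMSEQ_metric[of X]) (use X lim in \<open>auto intro: random_var_borel_measurable\<close>)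
  ultimately show ?thesis by (intro random_var_if_separable)
qed

lemma random_var_compose2:
  assumes "random_var P X" "random_var P Y" and h: "\<And>a b. isCont (\<lambda>p. h (fst p) (snd p)) (a, b)"
  shows "random_var P (\<lambda>w. h (X w) (Y w))"
proof -
  obtain s where s: "\<And>i. simple_function P (s i)" "\<And>w. w \<in> space P \<Longrightarrow> (\<lambda>i. s i w) \<longlonglongrightarrow> X w"
    using assms(1) unfolding random_var_def by blast
  obtain s' where s': "\<And>i. simple_function P (s' i)" "\<And>w. w \<in> space P \<Longrightarrow> (\<lambda>i. s' i w) \<longlonglongrightarrow> Y w"
    using assms(2) unfolding random_var_def by blast
  have "(\<lambda>i. h (s i w) (s' i w)) \<longlonglongrightarrow> h (X w) (Y w)" if "w \<in> space P" for w
    using isCont_tendsto_compose[OF h tendsto_Pair[OF s(2)[OF that] s'(2)[OF that]]] by simp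
  then show ?thesis
    unfolding random_var_def
    by (intro exI[of _ "\<lambda>i w. h (s i w) (s' i w)"]) (use s(1) s'(1) simple_function_compose2 in blast)
qed

lemma random_var_const: "random_var P (\<lambda>w. c)"
  unfolding random_var_def by (intro exI[of _ "\<lambda>_ _. c"]) auto

lemma random_var_add: "random_var P X \<Longrightarrow> random_var P Y \<Longrightarrow> random_var P (\<lambda>w. X w + Y w)"
  by (rule random_var_compose2) (auto intro!: continuous_intros)

lemma random_var_diff: "random_var P X \<Longrightarrow> random_var P Y \<Longrightarrow> random_var P (\<lambda>w. X w - Y w)"
  by (rule random_var_compose2) (auto intro!: continuous_intros)

lemma random_var_scaleR: "random_var P X \<Longrightarrow> random_var P (\<lambda>w. c *\<^sub>R X w)"
  by (rule random_var_compose2[of P X X]) (auto intro!: continuous_intros)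

lemma random_var_restrict:
  assumes "random_var P X" "{w\<in>space P. Q w} \<in> sets P"
  shows "random_var P (\<lambda>w. if Q w then X w else 0)"
proof -
  obtain s where s: "\<And>i. simple_function P (s i)" "\<And>w. w \<in> space P \<Longrightarrow> (\<lambda>i. s i w) \<longlonglongrightarrow> X w"
    using assms(1) unfolding random_var_def by blast
  show ?thesis
    unfolding random_var_def
    by (intro exI[of _ "\<lambda>i w. if Q w then s i w else 0"] conjI allI ballI simple_function_If
        simple_function_const s(1) assms(2)) (use s(2) in auto)
qed

section \<open>Square integrable random variables\<close>

definition sq_int_var :: "'w measure \<Rightarrow> ('w \<Rightarrow> 'h::banach) \<Rightarrow> bool" where
  "sq_int_var P X \<longleftrightarrow> random_var P X \<and> integrable P (\<lambda>w. (norm (X w))\<^sup>2)"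

lemma random_var_norm_sq_measurable:
  assumes "random_var P X"
  shows "(\<lambda>w. (norm (X w))\<^sup>2) \<in> borel_measurable P"
  using random_var_borel_measurable[OF assms] by measurable

lemma norm_add_sq_le: "(norm (x + y))\<^sup>2 \<le> 2 * (norm x)\<^sup>2 + 2 * (norm y)\<^sup>2"
  for x y :: "'a::real_normed_vector"
proof -
  have "(norm (x + y))\<^sup>2 \<le> (norm x + norm y)\<^sup>2"
    by (intro power_mono norm_triangle_ineq norm_ge_zero)
  also have "\<dots> \<le> 2 * (norm x)\<^sup>2 + 2 * (norm y)\<^sup>2"
    using zero_le_power2[of "norm x - norm y"] by (simp add: power2_eq_square algebra_simps)
  finally show ?thesis .
qed

lemma sq_int_var_add:
  assumes "sq_int_var P X" "sq_int_var P Y"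
  shows "sq_int_var P (\<lambda>w. X w + Y w)"
  unfolding sq_int_var_def
proof
  show rv: "random_var P (\<lambda>w. X w + Y w)"
    using assms by (simp add: sq_int_var_def random_var_add)
  show "integrable P (\<lambda>w. (norm (X w + Y w))\<^sup>2)"
  proof (rule Bochner_Integration.integrable_bound)
    show "integrable P (\<lambda>w. 2 * (norm (X w))\<^sup>2 + 2 * (norm (Y w))\<^sup>2)"
      using assms by (simp add: sq_int_var_def)
  qed (use random_var_norm_sq_measurable[OF rv] norm_add_sq_le in auto)
qed

lemma sq_int_var_scaleR: "sq_int_var P X \<Longrightarrow> sq_int_var P (\<lambda>w. c *\<^sub>R X w)"
  by (simp add: sq_int_var_def random_var_scaleR power_mult_distrib)

lemma sq_int_var_diff: "sq_int_var P X \<Longrightarrow> sq_int_var P Y \<Longrightarrow> sq_int_var P (\<lambda>w. X w - Y w)"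
  using sq_int_var_add[of P X "\<lambda>w. (-1) *\<^sub>R Y w"] sq_int_var_scaleR[of P Y "-1"] by simp

lemma sq_int_var_zero: "sq_int_var P (\<lambda>w. 0)"
  by (simp add: sq_int_var_def random_var_const)

text \<open>For positive weights \<open>a\<close>, \<open>b\<close> the integrand satisfies the
  pointwise bound \<open>pt\<close>. If the weights dominate the two norms, integration yields (a +
  b)^2, with no detour through Cauchy-Schwarz.\<close>

lemma Minkowski_L2:
  assumes "sq_int_var P X" "sq_int_var P Y"
  shows "sqrt (\<integral>w. (norm (X w + Y w))\<^sup>2 \<partial>P) \<le> sqrt (\<integral>w. (norm (X w))\<^sup>2 \<partial>P) + sqrt (\<integral>w. (norm (Y w))\<^sup>2 \<partial>P)"
    (is "sqrt ?S \<le> sqrt ?A + sqrt ?B")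
proof (rule field_le_epsilon)
  fix e :: real assume e: "0 < e"
  \<comment> \<open>The shift by \<open>e / 2\<close> keeps both weights positive even when a norm
    vanishes.\<close>
  define a b where "a = sqrt ?A + e / 2" and "b = sqrt ?B + e / 2"
  have AB: "0 \<le> ?A" "0 \<le> ?B" by auto
  then have ab: "0 < a" "0 < b" using e by (auto simp: a_def b_def add_nonneg_pos)
  have "sqrt ?A \<le> a" "sqrt ?B \<le> b" using e by (auto simp: a_def b_def)
  then have AB_le: "?A \<le> a\<^sup>2" "?B \<le> b\<^sup>2"
    using AB sqrt_le_D by blast+
  have pt: "(norm (x + y))\<^sup>2 \<le> (1 + b / a) * (norm x)\<^sup>2 + (1 + a / b) * (norm y)\<^sup>2" for x y :: 'b
  proof -
    have "(norm (x + y))\<^sup>2 \<le> (norm x + norm y)\<^sup>2"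
      by (intro power_mono norm_triangle_ineq norm_ge_zero)
    also have "\<dots> \<le> (1 + b / a) * (norm x)\<^sup>2 + (1 + a / b) * (norm y)\<^sup>2"
    proof -
      have "0 \<le> (b * norm x - a * norm y)\<^sup>2 / (a * b)" using ab by simp
      also have "\<dots> = b / a * (norm x)\<^sup>2 + a / b * (norm y)\<^sup>2 - 2 * norm x * norm y"
        using ab by (simp add: field_simps power2_eq_square)
      finally show ?thesis by (simp add: power2_eq_square algebra_simps)
    qed
    finally show ?thesis .
  qed
  have int: "integrable P (\<lambda>w. (norm (X w))\<^sup>2)" "integrable P (\<lambda>w. (norm (Y w))\<^sup>2)"
    "integrable P (\<lambda>w. (norm (X w + Y w))\<^sup>2)"
    using assms sq_int_var_add[OF assms] by (auto simp: sq_int_var_def)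
  have "?S \<le> (\<integral>w. (1 + b / a) * (norm (X w))\<^sup>2 + (1 + a / b) * (norm (Y w))\<^sup>2 \<partial>P)"
    using int pt by (intro integral_mono) auto
  also have "\<dots> = (1 + b / a) * ?A + (1 + a / b) * ?B"
    using int by simp
  also have "\<dots> \<le> (1 + b / a) * a\<^sup>2 + (1 + a / b) * b\<^sup>2"
    using ab AB_le by (intro add_mono mult_left_mono) auto
  also have "\<dots> = (a + b)\<^sup>2"
    using ab by (simp add: field_simps power2_eq_square)
  finally have "sqrt ?S \<le> a + b"
    using ab by (intro real_le_lsqrt) auto
  then show "sqrt ?S \<le> sqrt ?A + sqrt ?B + e"
    by (simp add: a_def b_def)
qed

text \<open>The increments have summable integrals over a probability space, so almost every path
  converges absolutely; Fatou's lemma then carries the rate over to the limit.\<close>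

lemma Riesz_Fischer_L2:
  fixes X :: "nat \<Rightarrow> 'w \<Rightarrow> 'h::banach"
  assumes "prob_space P" and X: "\<And>n. sq_int_var P (X n)"
    and fast: "\<And>m n. n \<le> m \<Longrightarrow> (\<integral>w. (norm (X m w - X n w))\<^sup>2 \<partial>P) \<le> (2 * (1/2) ^ n)\<^sup>2"
  obtains Y where "sq_int_var P Y" "\<And>n. (\<integral>w. (norm (X n w - Y w))\<^sup>2 \<partial>P) \<le> (2 * (1/2) ^ n)\<^sup>2"
proof -
  interpret prob_space P by fact
  define g where "g n w = norm (X (Suc n) w - X n w)" for n w
  have rv: "random_var P (X n)" for n using X by (simp add: sq_int_var_def)
  have diff: "sq_int_var P (\<lambda>w. X m w - X n w)" for m n
    using X by (intro sq_int_var_diff)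
  have g_sq: "integrable P (\<lambda>w. (g n w)\<^sup>2)" for n
    using diff[of "Suc n" n] by (simp add: sq_int_var_def g_def)
  have g_meas [measurable]: "g n \<in> borel_measurable P" for n
    using measurable_compose[OF random_var_borel_measurable[OF random_var_diff[OF rv rv]]
        borel_measurable_norm, of "Suc n" n]
    by (simp add: g_def[abs_def])
  have g_le: "(\<integral>\<^sup>+w. ennreal (g n w) \<partial>P) \<le> ennreal (5 * (1/2) ^ n)" for n
  proof -
    text \<open>AM-GM, weighted so that both terms have integral of order \<open>2\<^sup>-\<^sup>n\<close>.\<close>
    have "g n w \<le> 2 ^ n * (g n w)\<^sup>2 + (1/2) ^ n" for w
    proof -
      have amgm: "b \<le> p * b\<^sup>2 + 1 / p" if "0 < p" "0 \<le> b" for p b :: real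
      proof -
        have "0 \<le> ((p * b - 1)\<^sup>2 + p * b) / p" using that by simp
        also have "(p * b - 1)\<^sup>2 + p * b = p * (p * b\<^sup>2 + 1 / p - b)"
          using that by (simp add: power2_eq_square algebra_simps)
        also have "p * (p * b\<^sup>2 + 1 / p - b) / p = p * b\<^sup>2 + 1 / p - b"
          using that by simp
        finally show ?thesis by simp
      qed
      show ?thesis
        using amgm[of "2 ^ n" "g n w"] by (simp add: g_def power_one_over)
    qed
    then have "(\<integral>\<^sup>+w. ennreal (g n w) \<partial>P) \<le> (\<integral>\<^sup>+w. ennreal (2 ^ n * (g n w)\<^sup>2 + (1/2) ^ n) \<partial>P)"
      by (intro nn_integral_mono ennreal_leI)
    also have "\<dots> = ennreal (\<integral>w. 2 ^ n * (g n w)\<^sup>2 + (1/2) ^ n \<partial>P)"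
      using g_sq by (intro nn_integral_eq_integral) auto
    also have "(\<integral>w. 2 ^ n * (g n w)\<^sup>2 + (1/2) ^ n \<partial>P) = 2 ^ n * (\<integral>w. (g n w)\<^sup>2 \<partial>P) + (1/2) ^ n"
      using g_sq by (simp add: prob_space)
    also have "\<dots> \<le> 2 ^ n * (2 * (1/2) ^ n)\<^sup>2 + (1/2) ^ n"
      using fast[of n "Suc n"] by (intro add_right_mono mult_left_mono) (auto simp: g_def)
    \<comment> \<open>The 5 is 4 + 1, since 2^n * 4 * 4^(-n) equals 4 * 2^(-n).\<close>
    also have "\<dots> = 5 * (1/2) ^ n"
      by (simp add: power2_eq_square power_one_over field_simps)
    finally show ?thesis by (simp add: ennreal_leI)
  qed
  have "(\<integral>\<^sup>+w. (\<Sum>n. ennreal (g n w)) \<partial>P) = (\<Sum>n. \<integral>\<^sup>+w. ennreal (g n w) \<partial>P)"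
    by (intro nn_integral_suminf) auto
  also have "\<dots> \<le> (\<Sum>n. ennreal (5 * (1/2) ^ n))"
    using g_le by (intro suminf_le) auto
  also have "\<dots> = ennreal (\<Sum>n. 5 * (1/2) ^ n)"
    by (intro suminf_ennreal2 summable_mult summable_geometric) auto
  finally have "(\<integral>\<^sup>+w. (\<Sum>n. ennreal (g n w)) \<partial>P) \<noteq> \<infinity>"
    by (auto simp: top_unique)
  then have AE_fin: "AE w in P. (\<Sum>n. ennreal (g n w)) \<noteq> \<infinity>"
    by (intro nn_integral_PInf_AE) auto
  define good where "good w \<longleftrightarrow> (\<Sum>n. ennreal (g n w)) \<noteq> \<infinity>" for w
  have good_set: "{w\<in>space P. good w} \<in> sets P"
    unfolding good_def by measurable
  have conv: "convergent (\<lambda>n. X n w)" if "good w" for w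
  proof -
    have "summable (\<lambda>n. norm (X (Suc n) w - X n w))"
      using that summable_suminf_not_top[of "\<lambda>n. g n w"] by (simp add: good_def g_def)
    then have "summable (\<lambda>n. X (Suc n) w - X n w)" by (rule summable_norm_cancel)
    then have "convergent (\<lambda>n. X n w - X 0 w)"
      by (simp add: summable_iff_convergent sum_lessThan_telescope[of "\<lambda>n. X n w"])
    then show ?thesis by (simp add: convergent_diff_const_right_iff)
  qed
  \<comment> \<open>\<open>random_var\<close> demands convergence at every point of the space, so
    sequence and limit are set to 0 on the exceptional null set.\<close>
  define Y where "Y w = (if good w then lim (\<lambda>n. X n w) else 0)" for w
  have Y_lim: "(\<lambda>n. X n w) \<longlonglongrightarrow> Y w" if "good w" for w
    using conv[OF that] that by (simp add: Y_def convergent_LIMSEQ_iff)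
  have rvY: "random_var P Y"
  proof (rule random_var_LIMSEQ)
    show "random_var P (\<lambda>w. if good w then X n w else 0)" for n
      by (intro random_var_restrict rv good_set)
    show "(\<lambda>n. if good w then X n w else 0) \<longlonglongrightarrow> Y w" for w
      by (cases "good w") (auto simp: Y_lim, simp add: Y_def)
  qed
  have Fatou: "(\<integral>\<^sup>+w. ennreal ((norm (X n w - Y w))\<^sup>2) \<partial>P) \<le> ennreal ((2 * (1/2) ^ n)\<^sup>2)" for n
  proof -
    have "AE w in P. ennreal ((norm (X n w - Y w))\<^sup>2) = liminf (\<lambda>m. ennreal ((norm (X m w - X n w))\<^sup>2))"
      using AE_fin
    proof eventually_elim
      case (elim w)
      then have "(\<lambda>m. X m w) \<longlonglongrightarrow> Y w" by (intro Y_lim) (simp add: good_def)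
      then have "(\<lambda>m. ennreal ((norm (X m w - X n w))\<^sup>2)) \<longlonglongrightarrow> ennreal ((norm (Y w - X n w))\<^sup>2)"
        by (intro tendsto_intros)
      then show ?case
        using lim_imp_Liminf[OF sequentially_bot] norm_minus_commute[of "X n w" "Y w"] by metis
    qed
    then have "(\<integral>\<^sup>+w. ennreal ((norm (X n w - Y w))\<^sup>2) \<partial>P) =
        (\<integral>\<^sup>+w. liminf (\<lambda>m. ennreal ((norm (X m w - X n w))\<^sup>2)) \<partial>P)"
      by (rule nn_integral_cong_AE)
    also have "\<dots> \<le> liminf (\<lambda>m. \<integral>\<^sup>+w. ennreal ((norm (X m w - X n w))\<^sup>2) \<partial>P)"
      using random_var_norm_sq_measurable[OF random_var_diff[OF rv rv]]
      by (intro nn_integral_liminf measurable_compose[OF _ measurable_ennreal])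
    also have "\<dots> \<le> ennreal ((2 * (1/2) ^ n)\<^sup>2)"
    proof (rule Liminf_le)
      have "(\<integral>\<^sup>+w. ennreal ((norm (X m w - X n w))\<^sup>2) \<partial>P) \<le> ennreal ((2 * (1/2) ^ n)\<^sup>2)" if "n \<le> m" for m
        using diff[of m n] fast[OF that]
        by (subst nn_integral_eq_integral) (auto simp: sq_int_var_def ennreal_leI)
      then show "\<forall>\<^sub>F m in sequentially. (\<integral>\<^sup>+w. ennreal ((norm (X m w - X n w))\<^sup>2) \<partial>P) \<le> ennreal ((2 * (1/2) ^ n)\<^sup>2)"
        unfolding eventually_sequentially by blast
    qed simp
    finally show ?thesis .
  qed
  have sq: "sq_int_var P (\<lambda>w. X n w - Y w)" for n
    unfolding sq_int_var_def
  proof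
    show rv': "random_var P (\<lambda>w. X n w - Y w)" by (intro random_var_diff rv rvY)
    show "integrable P (\<lambda>w. (norm (X n w - Y w))\<^sup>2)"
      by (rule integrableI_nonneg)
        (use Fatou[of n] random_var_norm_sq_measurable[OF rv'] in \<open>auto simp: le_less_trans\<close>)
  qed
  show ?thesis
  proof (rule that)
    show "sq_int_var P Y"
      using sq_int_var_diff[OF X[of 0] sq[of 0]] by simp
    show "(\<integral>w. (norm (X n w - Y w))\<^sup>2 \<partial>P) \<le> (2 * (1/2) ^ n)\<^sup>2" for n
    proof -
      have "ennreal (\<integral>w. (norm (X n w - Y w))\<^sup>2 \<partial>P) \<le> ennreal ((2 * (1/2) ^ n)\<^sup>2)"
        using Fatou[of n] sq[of n] by (subst (asm) nn_integral_eq_integral) (auto simp: sq_int_var_def)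
      then show ?thesis by (simp add: ennreal_le_iff)
    qed
  qed
qed

section \<open>The Banach space of classes of square integrable random variables\<close>

definition L2_norm :: "'w measure \<Rightarrow> ('w \<Rightarrow> 'h::banach) set \<Rightarrow> real" where
  "L2_norm P A = sqrt (E_sq P A)"

lemma ae_class_cong:
  assumes "AE w in P. X w = Y w"
  shows "ae_class P X = ae_class P Y"
proof -
  have "(AE w in P. Z w = X w) \<longleftrightarrow> (AE w in P. Z w = Y w)" for Z
    using assms by (intro eventually_subst) auto
  then show ?thesis by (auto simp: ae_class_def)
qed

lemma L2_cases:
  assumes "A \<in> carrier (L2 P)"
  obtains X where "A = ae_class P X" "sq_int_var P X"
  using assms by (auto simp: L2_def sq_int_var_def)

lemma ae_class_in_L2: "sq_int_var P X \<Longrightarrow> ae_class P X \<in> carrier (L2 P)"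
  by (auto simp: L2_def sq_int_var_def)

lemma L2_add:
  assumes "sq_int_var P X" "sq_int_var P Y"
  shows "ae_class P X \<oplus>\<^bsub>L2 P\<^esub> ae_class P Y = ae_class P (\<lambda>w. X w + Y w)"
proof -
  have "AE w in P. rep (ae_class P X) w = X w" "AE w in P. rep (ae_class P Y) w = Y w"
    using assms by (auto intro: rep_ae_class simp: sq_int_var_def)
  then have "AE w in P. rep (ae_class P X) w + rep (ae_class P Y) w = X w + Y w"
    by eventually_elim simp
  then show ?thesis by (simp add: L2_def ae_class_cong)
qed

lemma L2_smult:
  assumes "sq_int_var P X"
  shows "c \<odot>\<^bsub>L2 P\<^esub> ae_class P X = ae_class P (\<lambda>w. c *\<^sub>R X w)"
proof -
  have "AE w in P. rep (ae_class P X) w = X w"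
    using assms by (auto intro: rep_ae_class simp: sq_int_var_def)
  then have "AE w in P. c *\<^sub>R rep (ae_class P X) w = c *\<^sub>R X w"
    by eventually_elim simp
  then show ?thesis by (simp add: L2_def ae_class_cong)
qed

lemma L2_zero: "\<zero>\<^bsub>L2 P\<^esub> = ae_class P (\<lambda>w. 0)"
  by (simp add: L2_def)

lemma L2_norm_ae_class:
  "sq_int_var P X \<Longrightarrow> L2_norm P (ae_class P X) = sqrt (\<integral>w. (norm (X w))\<^sup>2 \<partial>P)"
  by (simp add: L2_norm_def E_sq_ae_class sq_int_var_def)

lemma module_L2: "Module.module real_field (L2 P :: (real, ('w \<Rightarrow> 'h::banach) set) module)"
proof (rule moduleI)
  show "cring real_field" by (rule cring_real_field)
  show "abelian_group (L2 P :: (real, ('w \<Rightarrow> 'h) set) module)"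
  proof (rule abelian_groupI)
    fix A B :: "('w \<Rightarrow> 'h) set" assume A: "A \<in> carrier (L2 P)" and B: "B \<in> carrier (L2 P)"
    from A obtain X where X: "A = ae_class P X" "sq_int_var P X" by (rule L2_cases)
    from B obtain Y where Y: "B = ae_class P Y" "sq_int_var P Y" by (rule L2_cases)
    show "A \<oplus>\<^bsub>L2 P\<^esub> B \<in> carrier (L2 P)"
      unfolding X(1) Y(1) L2_add[OF X(2) Y(2)] by (intro ae_class_in_L2 sq_int_var_add X Y)
    show "A \<oplus>\<^bsub>L2 P\<^esub> B = B \<oplus>\<^bsub>L2 P\<^esub> A"
      unfolding X(1) Y(1) L2_add[OF X(2) Y(2)] L2_add[OF Y(2) X(2)] by (simp only: add.commute)
    fix C :: "('w \<Rightarrow> 'h) set" assume "C \<in> carrier (L2 P)"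
    then obtain Z where Z: "C = ae_class P Z" "sq_int_var P Z" by (rule L2_cases)
    show "A \<oplus>\<^bsub>L2 P\<^esub> B \<oplus>\<^bsub>L2 P\<^esub> C = A \<oplus>\<^bsub>L2 P\<^esub> (B \<oplus>\<^bsub>L2 P\<^esub> C)"
      unfolding X(1) Y(1) Z(1) L2_add[OF X(2) Y(2)] L2_add[OF Y(2) Z(2)]
        L2_add[OF sq_int_var_add[OF X(2) Y(2)] Z(2)] L2_add[OF X(2) sq_int_var_add[OF Y(2) Z(2)]]
      by (simp only: add.assoc)
  next
    show "\<zero>\<^bsub>L2 P\<^esub> \<in> carrier (L2 P :: (real, ('w \<Rightarrow> 'h) set) module)"
      by (simp add: L2_zero ae_class_in_L2 sq_int_var_zero)
    fix A :: "('w \<Rightarrow> 'h) set" assume "A \<in> carrier (L2 P)"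
    then obtain X where X: "A = ae_class P X" "sq_int_var P X" by (rule L2_cases)
    show "\<zero>\<^bsub>L2 P\<^esub> \<oplus>\<^bsub>L2 P\<^esub> A = A"
      using X by (simp add: L2_add L2_zero sq_int_var_zero)
    have "ae_class P (\<lambda>w. (-1) *\<^sub>R X w) \<oplus>\<^bsub>L2 P\<^esub> A = \<zero>\<^bsub>L2 P\<^esub>"
      unfolding X(1) L2_add[OF sq_int_var_scaleR[OF X(2)] X(2)] L2_zero by simp
    then show "\<exists>B\<in>carrier (L2 P). B \<oplus>\<^bsub>L2 P\<^esub> A = \<zero>\<^bsub>L2 P\<^esub>"
      using ae_class_in_L2[OF sq_int_var_scaleR[OF X(2)]] by blast
  qed
next
  fix a b and A :: "('w \<Rightarrow> 'h) set" assume "A \<in> carrier (L2 P)"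
  then obtain X where X: "A = ae_class P X" "sq_int_var P X" by (rule L2_cases)
  show "a \<odot>\<^bsub>L2 P\<^esub> A \<in> carrier (L2 P)"
    using X by (simp add: L2_smult ae_class_in_L2 sq_int_var_scaleR)
  show "(a \<oplus>\<^bsub>real_field\<^esub> b) \<odot>\<^bsub>L2 P\<^esub> A = a \<odot>\<^bsub>L2 P\<^esub> A \<oplus>\<^bsub>L2 P\<^esub> b \<odot>\<^bsub>L2 P\<^esub> A"
    using X by (simp add: L2_smult L2_add sq_int_var_scaleR scaleR_add_left)
  show "(a \<otimes>\<^bsub>real_field\<^esub> b) \<odot>\<^bsub>L2 P\<^esub> A = a \<odot>\<^bsub>L2 P\<^esub> (b \<odot>\<^bsub>L2 P\<^esub> A)"
    using X by (simp add: L2_smult sq_int_var_scaleR)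
  show "\<one>\<^bsub>real_field\<^esub> \<odot>\<^bsub>L2 P\<^esub> A = A"
    using X by (simp add: L2_smult)
  fix B :: "('w \<Rightarrow> 'h) set" assume "B \<in> carrier (L2 P)"
  then obtain Y where Y: "B = ae_class P Y" "sq_int_var P Y" by (rule L2_cases)
  show "a \<odot>\<^bsub>L2 P\<^esub> (A \<oplus>\<^bsub>L2 P\<^esub> B) = a \<odot>\<^bsub>L2 P\<^esub> A \<oplus>\<^bsub>L2 P\<^esub> a \<odot>\<^bsub>L2 P\<^esub> B"
    using X Y by (simp add: L2_smult L2_add sq_int_var_add sq_int_var_scaleR scaleR_add_right)
qed

lemma normed_space_on_L2:
  "normed_space_on (L2 P :: (real, ('w \<Rightarrow> 'h::banach) set) module) (L2_norm P)"
proof (intro normed_space_on.intro normed_space_on_axioms.intro module_L2)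
  fix A :: "('w \<Rightarrow> 'h) set" assume "A \<in> carrier (L2 P)"
  then obtain X where X: "A = ae_class P X" "sq_int_var P X"
    by (rule L2_cases)
  show "0 \<le> L2_norm P A" by (simp add: L2_norm_def E_sq_def)
  have "L2_norm P A = 0 \<longleftrightarrow> (\<integral>w. (norm (X w))\<^sup>2 \<partial>P) = 0"
    using X by (simp add: L2_norm_ae_class)
  also have "\<dots> \<longleftrightarrow> (AE w in P. (norm (X w))\<^sup>2 = 0)"
    using X by (intro integral_nonneg_eq_0_iff_AE) (auto simp: sq_int_var_def)
  also have "\<dots> \<longleftrightarrow> A = \<zero>\<^bsub>L2 P\<^esub>"
    using X by (simp add: L2_zero ae_class_eq_iff sq_int_var_def random_var_const)
  finally show "(L2_norm P A = 0) = (A = \<zero>\<^bsub>L2 P\<^esub>)" .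
  show "L2_norm P (c \<odot>\<^bsub>L2 P\<^esub> A) = \<bar>c\<bar> * L2_norm P A" for c
    using X by (simp add: L2_smult L2_norm_ae_class sq_int_var_scaleR power_mult_distrib real_sqrt_mult)
  fix B :: "('w \<Rightarrow> 'h) set" assume "B \<in> carrier (L2 P)"
  then obtain Y where Y: "B = ae_class P Y" "sq_int_var P Y"
    by (rule L2_cases)
  show "L2_norm P (A \<oplus>\<^bsub>L2 P\<^esub> B) \<le> L2_norm P A + L2_norm P B"
    using X Y Minkowski_L2[of P X Y] by (simp add: L2_add L2_norm_ae_class sq_int_var_add)
qed

lemma L2_minus:
  fixes X Y :: "'w \<Rightarrow> 'h::banach"
  assumes "sq_int_var P X" "sq_int_var P Y"
  shows "ae_class P X \<ominus>\<^bsub>L2 P\<^esub> ae_class P Y = ae_class P (\<lambda>w. X w - Y w)"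
proof -
  interpret normed_space_on "L2 P :: (real, ('w \<Rightarrow> 'h) set) module" "L2_norm P" by (rule normed_space_on_L2)
  show ?thesis
    using assms L2_add[OF assms(1) sq_int_var_scaleR[OF assms(2), of "-1"]]
    by (simp add: a_minus_def minus_eq_smult ae_class_in_L2 L2_smult)
qed

lemma banach_space_on_L2:
  assumes "prob_space P"
  shows "banach_space_on (L2 P :: (real, ('w \<Rightarrow> 'h::banach) set) module) (L2_norm P)"
proof -
  interpret normed_space_on "L2 P :: (real, ('w \<Rightarrow> 'h) set) module" "L2_norm P" by (rule normed_space_on_L2)
  show ?thesis
  proof (rule banach_space_on_if_fast_Cauchy_converges)
    fix u :: "nat \<Rightarrow> ('w \<Rightarrow> 'h) set"
    assume u: "\<And>n. u n \<in> carrier (L2 P)"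
      and fast: "\<And>n. L2_norm P (u (Suc n) \<ominus>\<^bsub>L2 P\<^esub> u n) \<le> (1/2) ^ n"
    have "\<forall>n. \<exists>X. u n = ae_class P X \<and> sq_int_var P X"
      using u by (meson L2_cases)
    then obtain X where X: "\<And>n. u n = ae_class P (X n)" "\<And>n. sq_int_var P (X n)" by metis
    have dist: "(\<integral>w. (norm (X m w - X n w))\<^sup>2 \<partial>P) \<le> (2 * (1/2) ^ n)\<^sup>2" if "n \<le> m" for m n
    proof -
      have "L2_norm P (u m \<ominus>\<^bsub>L2 P\<^esub> u n) \<le> 2 * (1/2) ^ n"
        using fast_Cauchy_dist_le[of u 1 n m] u fast that by simp
      then show ?thesis
        using X(2) by (intro sqrt_le_D) (simp add: X(1) L2_minus L2_norm_ae_class sq_int_var_diff)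
    qed
    obtain Y where Y: "sq_int_var P Y" "\<And>n. (\<integral>w. (norm (X n w - Y w))\<^sup>2 \<partial>P) \<le> (2 * (1/2) ^ n)\<^sup>2"
    proof (rule Riesz_Fischer_L2[OF assms X(2) dist])
      fix Y assume "sq_int_var P Y" "\<And>n. (\<integral>w. (norm (X n w - Y w))\<^sup>2 \<partial>P) \<le> (2 * (1/2) ^ n)\<^sup>2"
      then show thesis by (rule that)
    qed
    have le: "L2_norm P (u n \<ominus>\<^bsub>L2 P\<^esub> ae_class P Y) \<le> 2 * (1/2) ^ n" for n
      using Y X(2) by (simp add: X(1) L2_minus L2_norm_ae_class sq_int_var_diff real_le_lsqrt)
    have null: "(\<lambda>n. 2 * (1/2) ^ n) \<longlonglongrightarrow> (0::real)"
      using tendsto_mult[OF tendsto_const LIMSEQ_power_zero[of "1/2 :: real"], of 2] by simp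
    have "(\<lambda>n. L2_norm P (u n \<ominus>\<^bsub>L2 P\<^esub> ae_class P Y)) \<longlonglongrightarrow> 0"
      by (rule Lim_null_comparison[OF _ null]) (use le in \<open>auto simp: L2_norm_def E_sq_def\<close>)
    then show "\<exists>l\<in>carrier (L2 P). (\<lambda>n. L2_norm P (u n \<ominus>\<^bsub>L2 P\<^esub> l)) \<longlonglongrightarrow> 0"
      using ae_class_in_L2[OF Y(1)] by blast
  qed
qed

section \<open>Square-mean pseudo almost periodic processes\<close>

lemma E_sq_eq_L2_norm_sq: "E_sq P A = (L2_norm P A)\<^sup>2"
  by (simp add: L2_norm_def E_sq_def)

text \<open>\<open>E_sq\<close> is only the square of a norm; this and the next equivalence allow
  the definitions to be read in terms of \<open>L2_norm\<close>, where the abstract theory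
  applies.\<close>

lemma tendsto_E_sq_iff: "((\<lambda>s. E_sq P (f s)) \<longlongrightarrow> 0) F \<longleftrightarrow> ((\<lambda>s. L2_norm P (f s)) \<longlongrightarrow> 0) F"
proof
  assume "((\<lambda>s. E_sq P (f s)) \<longlongrightarrow> 0) F"
  then show "((\<lambda>s. L2_norm P (f s)) \<longlongrightarrow> 0) F"
    unfolding L2_norm_def using tendsto_real_sqrt[of "\<lambda>s. E_sq P (f s)" 0 F] by simp
next
  assume "((\<lambda>s. L2_norm P (f s)) \<longlongrightarrow> 0) F"
  then show "((\<lambda>s. E_sq P (f s)) \<longlongrightarrow> 0) F"
    unfolding E_sq_eq_L2_norm_sq using tendsto_power[of "\<lambda>s. L2_norm P (f s)" 0 F 2] by simp
qed

lemma bounded_E_sq_iff: "bdd_above (range (\<lambda>t. E_sq P (x t))) \<longleftrightarrow> (\<exists>B. \<forall>t. L2_norm P (x t) \<le> B)"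
proof
  assume "bdd_above (range (\<lambda>t. E_sq P (x t)))"
  then obtain B where "\<And>t. E_sq P (x t) \<le> B" by (auto simp: bdd_above_def)
  then have "\<forall>t. L2_norm P (x t) \<le> sqrt B"
    by (simp add: L2_norm_def)
  then show "\<exists>B. \<forall>t. L2_norm P (x t) \<le> B" ..
next
  assume "\<exists>B. \<forall>t. L2_norm P (x t) \<le> B"
  then obtain B where "\<And>t. L2_norm P (x t) \<le> B" by blast
  then have "E_sq P (x t) \<le> B\<^sup>2" for t
    unfolding E_sq_eq_L2_norm_sq by (intro power_mono) (auto simp: L2_norm_def E_sq_def)
  then show "bdd_above (range (\<lambda>t. E_sq P (x t)))"
    by (auto intro!: bdd_aboveI)
qed

lemma process_stoch_continuous_iff:
  "process P x \<and> stoch_continuous P x \<longleftrightarrow> normed_space_on.cont_fun (L2 P) (L2_norm P) x"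
  by (simp add: normed_space_on.cont_fun_def[OF normed_space_on_L2] process_def stoch_continuous_def
      tendsto_E_sq_iff)

lemma sq_mean_ap_iff:
  fixes x :: "real \<Rightarrow> ('w \<Rightarrow> 'h::banach) set"
  shows "sq_mean_ap P x \<longleftrightarrow> normed_space_on.ap_fun (L2 P) (L2_norm P) x"
proof -
  interpret normed_space_on "L2 P :: (real, ('w \<Rightarrow> 'h) set) module" "L2_norm P" by (rule normed_space_on_L2)
  let ?d = "\<lambda>s t. L2_norm P (x s \<ominus>\<^bsub>L2 P\<^esub> x t)"
  have "(\<forall>\<epsilon>>0. \<exists>l>0. \<forall>\<alpha>. \<exists>\<tau>\<in>{\<alpha>..\<alpha> + l}. (SUP t. ereal (E_sq P (x (t + \<tau>) \<ominus>\<^bsub>L2 P\<^esub> x t))) < ereal \<epsilon>) \<longleftrightarrow>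
      (\<forall>\<epsilon>>0. \<exists>l>0. \<forall>\<alpha>. \<exists>\<tau>\<in>{\<alpha>..\<alpha> + l}. \<forall>t. ?d (t + \<tau>) t \<le> \<epsilon>)"
    (is "?L \<longleftrightarrow> ?R")
  proof
    assume L: ?L
    show ?R
    proof (intro allI impI)
      fix e :: real assume "0 < e"
      then obtain l where l: "0 < l" "\<And>\<alpha>. \<exists>\<tau>\<in>{\<alpha>..\<alpha> + l}.
          (SUP t. ereal (E_sq P (x (t + \<tau>) \<ominus>\<^bsub>L2 P\<^esub> x t))) < ereal (e\<^sup>2)"
        using L[rule_format, of "e\<^sup>2"] by auto
      have "\<forall>t. ?d (t + \<tau>) t \<le> e"
        if "(SUP t. ereal (E_sq P (x (t + \<tau>) \<ominus>\<^bsub>L2 P\<^esub> x t))) < ereal (e\<^sup>2)" for \<tau>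
      proof
        fix t
        have "ereal (E_sq P (x (t + \<tau>) \<ominus>\<^bsub>L2 P\<^esub> x t)) < ereal (e\<^sup>2)"
          using that by (rule le_less_trans[OF SUP_upper[OF UNIV_I]])
        then show "?d (t + \<tau>) t \<le> e"
          unfolding L2_norm_def using \<open>0 < e\<close> by (intro real_le_lsqrt) (auto simp: E_sq_def)
      qed
      then show "\<exists>l>0. \<forall>\<alpha>. \<exists>\<tau>\<in>{\<alpha>..\<alpha> + l}. \<forall>t. ?d (t + \<tau>) t \<le> e"
        using l by meson
    qed
  next
    assume R: ?R
    show ?L
    proof (intro allI impI)
      fix e :: real assume "0 < e"
      \<comment> \<open>Squaring gives \<open>e / 2\<close>, and the gap to \<open>e\<close>
        restores the strict inequality that a supremum of pointwise bounds would lose.\<close>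
      then obtain l where l: "0 < l" "\<And>\<alpha>. \<exists>\<tau>\<in>{\<alpha>..\<alpha> + l}. \<forall>t. ?d (t + \<tau>) t \<le> sqrt (e / 2)"
        using R[rule_format, of "sqrt (e / 2)"] by auto
      have "(SUP t. ereal (E_sq P (x (t + \<tau>) \<ominus>\<^bsub>L2 P\<^esub> x t))) < ereal e"
        if "\<forall>t. ?d (t + \<tau>) t \<le> sqrt (e / 2)" for \<tau>
      proof -
        have "(SUP t. ereal (E_sq P (x (t + \<tau>) \<ominus>\<^bsub>L2 P\<^esub> x t))) \<le> ereal (e / 2)"
          using that by (intro SUP_least) (simp add: L2_norm_def)
        also have "\<dots> < ereal e" using \<open>0 < e\<close> by simp
        finally show ?thesis .
      qed
      then show "\<exists>l>0. \<forall>\<alpha>. \<exists>\<tau>\<in>{\<alpha>..\<alpha> + l}.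
          (SUP t. ereal (E_sq P (x (t + \<tau>) \<ominus>\<^bsub>L2 P\<^esub> x t))) < ereal e"
        using l by meson
    qed
  qed
  then show ?thesis
    using semimetric_fun[of x]
    by (auto simp: sq_mean_ap_def ap_fun_def ap_semimetric_def process_def stoch_continuous_def tendsto_E_sq_iff)
qed

lemma sq_mean_ergodic_iff: "sq_mean_ergodic P \<mu> x \<longleftrightarrow> normed_space_on.ergodic_fun (L2 P) (L2_norm P) \<mu> x"
proof -
  have "(\<lambda>r. 1 / measure \<mu> {-r..r} * (LINT t:{-r..r}|\<mu>. E_sq P (x t))) = mean_value \<mu> (\<lambda>t. (L2_norm P (x t))\<^sup>2)"
    by (simp add: mean_value_def fun_eq_iff E_sq_eq_L2_norm_sq)
  then show ?thesis
    by (simp add: normed_space_on.ergodic_fun_def[OF normed_space_on_L2] sq_mean_ergodic_def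
        stoch_bounded_def bounded_E_sq_iff flip: process_stoch_continuous_iff)
qed

lemma sq_mean_pap_iff:
  fixes x :: "real \<Rightarrow> ('w \<Rightarrow> 'h::banach) set"
  shows "sq_mean_pap P \<mu> x \<longleftrightarrow> normed_space_on.pap_fun (L2 P) (L2_norm P) \<mu> x"
proof -
  interpret normed_space_on "L2 P :: (real, ('w \<Rightarrow> 'h) set) module" "L2_norm P" by (rule normed_space_on_L2)
  \<comment> \<open>The decomposition alone yields continuity and boundedness of the sum, so the
    abstract notion delivers every clause of \<open>sq_mean_pap\<close>.\<close>
  have "process P x \<and> stoch_continuous P x" "stoch_bounded P x" if "pap_fun \<mu> x"
    using pap_fun_cont_fun[OF that] N_le_sup_N[OF that]
    by (auto simp: process_stoch_continuous_iff stoch_bounded_def bounded_E_sq_iff)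
  then show ?thesis
    unfolding sq_mean_pap_def sq_mean_ap_iff sq_mean_ergodic_iff pap_fun_def[symmetric] by blast
qed

theorem theorem6p8:
  fixes P :: "'w measure" and \<mu> :: "real measure"
  assumes "prob_space P" and "\<mu> \<in> measures_M"
  shows "banach_space_on (PAP P \<mu> :: (real, real \<Rightarrow> ('w \<Rightarrow> 'h::banach) set) module) (sup_norm P)"
proof -
  interpret banach_space_on "L2 P :: (real, ('w \<Rightarrow> 'h) set) module" "L2_norm P"
    by (rule banach_space_on_L2[OF assms(1)])
  \<comment> \<open>The fields of \<open>pap_space\<close> mirror those of \<open>PAP\<close>,
    \<open>undefined\<close> included, so the two records are literally equal.\<close>
  have "PAP P \<mu> = (pap_space \<mu> :: (real, real \<Rightarrow> ('w \<Rightarrow> 'h) set) module)"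
    by (simp add: PAP_def pap_space_def sq_mean_pap_iff)
  moreover have "sup_norm P = (sup_N :: (real \<Rightarrow> ('w \<Rightarrow> 'h) set) \<Rightarrow> real)"
    by (simp add: sup_norm_def sup_N_def L2_norm_def fun_eq_iff)
  ultimately show ?thesis
    using banach_space_on_pap_space[OF assms(2)] by simp
qed

end
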